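(* Let $n\ge 2$ be an integer. Let $V(n,k)$ and $H(n,k)$ be the number of coverings in $\mathbf{T}_n$ with exactly $k$ vertical dominoes and exactly $k$ horizontal dominoes, respectively. Define $$ W(n,k) := 2\sum_{i=1}^{\left\lfloor \frac{n-1}{2}\right\rfloor}\ \left(\sum_{k_1+k_2 = k-(n-i-1)} S(n-i-2,k_1)\,S(i-1,k_2)\right) + \sum_{k_1+k_2=k} S\!\left(\left\lfloor\tfrac{n-2}{2}\right\rfloor,k_1\right) S\!\left(\left\lfloor\tfrac{n-2}{2}\right\rfloor,k_2\right), $$ where the inner sums range over pairs of integers $(k_1,k_2)$ with the indicated sum, and $$ W_n(z) := 2\sum_{i=1}^{\left\lfloor\frac{n-1}{2}\right\rfloor} S_{n-i-2}(z)\,S_{i-1}(z)\,z^{n-i-1} + \left(S_{\left\lfloor\frac{n-2}{2}\right\rfloor}(z)\right)^2 . $$ Then $W_n(z)=\sum_{k\ge 0}W(n,k)z^k$. Moreover, $W_n(z)=\sum_{k\ge 0}V(n,k)z^k$ if $n$ is even, and $W_n(z)=\sum_{k\ge 0}H(n,k)z^k$ if $n$ is odd.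
   Context: A tatami covering of the $n\times n$ grid is an exact covering of the grid, without overlaps, by $1\times 1$ monominoes, $1\times 2$ horizontal dominoes (one row, two columns) and $2\times 1$ vertical dominoes (two rows, one column), placed on grid squares, in which no four tiles meet (i.e. no point is a common corner of four distinct tiles). $\mathbf{T}_n$ denotes the set of tatami coverings of the $n\times n$ grid with exactly $n$ monominoes that have a monomino in the top left corner and a monomino in the top right corner. Coverings are counted as fixed objects (not up to symmetry). For integers $s\ge 0$ and $k$, $S(s,k)$ is the number of subsets of $\{1,2,\ldots,s\}$ whose elements sum to $k$ (so $S(s,k)=0$ for $k<0$, and $S(0,0)=1$), and $S_s(z)=\sum_{k\in\mathbb{Z}}S(s,k)z^k=\prod_{i=1}^{s}(1+z^i)$, with $S_0(z)=1$. *)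

theory Defs
  imports Complex_Main "HOL-Computational_Algebra.Polynomial_FPS"
begin

(* A tile is given by its kind and its topmost, leftmost grid square (row, column).
   Rows are numbered from the top and columns from the left, both starting at 0. *)
datatype tile = Mono nat nat | HDom nat nat | VDom nat nat

fun cells :: "tile \<Rightarrow> (nat \<times> nat) set" where
  "cells (Mono r c) = {(r, c)}"
| "cells (HDom r c) = {(r, c), (r, Suc c)}"
| "cells (VDom r c) = {(r, c), (Suc r, c)}"

(* Grid square (r, c) is the unit square with corner points
   (r, c), (r, c + 1), (r + 1, c), (r + 1, c + 1). *)
fun corners :: "tile \<Rightarrow> (nat \<times> nat) set" where
  "corners (Mono r c) = {(r, c), (r, Suc c), (Suc r, c), (Suc r, Suc c)}"
| "corners (HDom r c) = {(r, c), (r, Suc (Suc c)), (Suc r, c), (Suc r, Suc (Suc c))}"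
| "corners (VDom r c) = {(r, c), (r, Suc c), (Suc (Suc r), c), (Suc (Suc r), Suc c)}"

fun is_mono :: "tile \<Rightarrow> bool" where
  "is_mono (Mono r c) = True"
| "is_mono (HDom r c) = False"
| "is_mono (VDom r c) = False"

fun is_hdom :: "tile \<Rightarrow> bool" where
  "is_hdom (Mono r c) = False"
| "is_hdom (HDom r c) = True"
| "is_hdom (VDom r c) = False"

fun is_vdom :: "tile \<Rightarrow> bool" where
  "is_vdom (Mono r c) = False"
| "is_vdom (HDom r c) = False"
| "is_vdom (VDom r c) = True"

definition covering :: "nat \<Rightarrow> tile set \<Rightarrow> bool" where
  "covering n T \<longleftrightarrow>
     (\<Union>t\<in>T. cells t) = {0..<n} \<times> {0..<n} \<and>
     (\<forall>t\<in>T. \<forall>u\<in>T. t \<noteq> u \<longrightarrow> cells t \<inter> cells u = {})"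

definition four_tiles_meet :: "tile set \<Rightarrow> bool" where
  "four_tiles_meet T \<longleftrightarrow> (\<exists>p. \<exists>F\<subseteq>T. card F = 4 \<and> (\<forall>t\<in>F. p \<in> corners t))"

definition tatami_covering :: "nat \<Rightarrow> tile set \<Rightarrow> bool" where
  "tatami_covering n T \<longleftrightarrow> covering n T \<and> \<not> four_tiles_meet T"

definition tatami_T :: "nat \<Rightarrow> tile set set" where
  "tatami_T n = {T. tatami_covering n T \<and> card {t \<in> T. is_mono t} = n \<and>
                    Mono 0 0 \<in> T \<and> Mono 0 (n - 1) \<in> T}"

definition count_V :: "nat \<Rightarrow> nat \<Rightarrow> nat" where
  "count_V n k = card {T \<in> tatami_T n. card {t \<in> T. is_vdom t} = k}"

definition count_H :: "nat \<Rightarrow> nat \<Rightarrow> nat" where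
  "count_H n k = card {T \<in> tatami_T n. card {t \<in> T. is_hdom t} = k}"

definition subset_sums :: "nat \<Rightarrow> int \<Rightarrow> nat" where
  "subset_sums s k = card {A. A \<subseteq> {1..s} \<and> int (\<Sum>A) = k}"

(* The sum of S(a, k1) * S(b, k2) over all integers k1, k2 with k1 + k2 = m. Only the
   finitely many pairs for which both factors are nonzero are listed, because a sum over
   an infinite index set would be 0 by convention; see finite_subset_sums_support. *)
definition subset_sums_conv :: "nat \<Rightarrow> nat \<Rightarrow> int \<Rightarrow> nat" where
  "subset_sums_conv a b m =
     (\<Sum>(k1, k2) \<in> {(k1, k2). k1 + k2 = m \<and> subset_sums a k1 \<noteq> 0 \<and> subset_sums b k2 \<noteq> 0}.
        subset_sums a k1 * subset_sums b k2)"

(* For n \<ge> 2 no subtraction on nat below is truncated. *)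
definition W_num :: "nat \<Rightarrow> nat \<Rightarrow> nat" where
  "W_num n k =
     2 * (\<Sum>i = 1..(n - 1) div 2. subset_sums_conv (n - i - 2) (i - 1) (int k - int (n - i - 1)))
     + subset_sums_conv ((n - 2) div 2) ((n - 2) div 2) (int k)"

definition S_poly :: "nat \<Rightarrow> int poly" where
  "S_poly s = (\<Prod>i = 1..s. 1 + monom 1 i)"

definition W_poly :: "nat \<Rightarrow> int poly" where
  "W_poly n =
     2 * (\<Sum>i = 1..(n - 1) div 2. S_poly (n - i - 2) * S_poly (i - 1) * monom 1 (n - i - 1))
     + (S_poly ((n - 2) div 2))\<^sup>2"

lemma finite_subset_sums_support: "finite {k. subset_sums s k \<noteq> 0}"
proof -
  have "k \<in> (\<lambda>A. int (\<Sum>A)) ` Pow {1..s}" if "subset_sums s k \<noteq> 0" for k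
  proof -
    have "{A. A \<subseteq> {1..s} \<and> int (\<Sum>A) = k} \<noteq> {}"
      using that unfolding subset_sums_def by (metis card.empty)
    then show ?thesis by blast
  qed
  then have "{k. subset_sums s k \<noteq> 0} \<subseteq> (\<lambda>A. int (\<Sum>A)) ` Pow {1..s}"
    by blast
  then show ?thesis
    by (rule finite_subset) simp
qed

lemma subset_sums_neg: "k < 0 \<Longrightarrow> subset_sums s k = 0"
proof -
  assume "k < 0"
  then have "{A. A \<subseteq> {1..s} \<and> int (\<Sum>A) = k} = {}"
    using of_nat_0_le_iff by (metis (mono_tags, lifting) Collect_empty_eq not_less)
  then show ?thesis
    unfolding subset_sums_def by (metis card.empty)
qed

(* The two descriptions of S_s(z), as a product and as a generating function, agree. *)
lemma coeff_S_poly: "coeff (S_poly s) k = int (subset_sums s (int k))"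
proof -
  have m: "(\<Prod>i\<in>B. monom (1::int) i) = monom 1 (\<Sum>B)" if "finite B" for B :: "nat set"
    using that by induction (simp_all add: mult_monom)
  have "S_poly s = (\<Sum>B\<in>Pow {1..s}. (\<Prod>i\<in>B. monom 1 i))"
    unfolding S_poly_def by (subst add.commute, subst prod_add) simp_all
  also have "\<dots> = (\<Sum>B\<in>Pow {1..s}. monom 1 (\<Sum>B))"
    by (rule sum.cong) (auto intro!: m intro: finite_subset)
  finally have "coeff (S_poly s) k = (\<Sum>B\<in>Pow {1..s}. if \<Sum>B = k then 1 else 0)"
    by (simp add: coeff_sum)
  also have "\<dots> = int (card {B \<in> Pow {1..s}. \<Sum>B = k})"
    by (simp add: sum.If_cases Int_def)
  finally show ?thesis
    by (simp add: subset_sums_def del: of_nat_sum)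
qed

end

theory Submission
  imports Defs
begin

text \<open>
  A tatami covering of the square with \<open>n\<close> monominoes is rigid, and the rigidity comes from an
  equality case.  Put a pyramid over the square, whose height at a point is twice the distance to
  the boundary in the maximum norm.  It is affine near the common edge of the two halves of a domino,
  so the heights at the two cell centres of a domino add up to the heights at the two ends of that
  edge, its seam.  Since every inner vertex of a tatami covering is the end of some seam, summing
  over all tiles gives: the sum of the heights of the monominoes, plus the sum over the vertices of
  the height times the number of superfluous seams, equals \<open>n\<close> (\<open>weighted_mono_count\<close>).
  With \<open>n\<close> monominoes, all of them therefore have height 1, that is, lie on the
  boundary, and no vertex lies on two seams (\<open>perfect_iff_tatami\<close>).

  Now turn the picture so that horizontal dominoes are the typical ones: leave it for even \<open>n\<close>,
  transpose it for odd \<open>n\<close>.  The tatami condition at the corners of a domino makes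
  dominoes continue along diagonals, so the two corner monominoes keep certain dominoes away from
  both diagonals of the square.  A domino closest to the centre then has no legal neighbours, and it
  follows that the left cell of every horizontal domino has odd coordinate sum (\<open>HDom_odd\<close>).  So
  the vertical dominoes form complete strips running along diagonals from boundary to boundary, and
  the rest is filled with horizontal bricks in the only possible way (\<open>eq_brick_tiling\<close>); conversely
  every set of strips that do not get in each other's way gives a covering
  (\<open>cornered_perfect_brick_tiling\<close>).

  Strips have two directions, and in each direction there is exactly one strip with \<open>k\<close> dominoes for
  each \<open>k\<close> from 1 to \<open>n - 2\<close>, apart from the one with \<open>n - 1\<close> that a corner monomino excludes.  Two
  strips of different directions with \<open>a\<close> and \<open>b\<close> dominoes are compatible if and only if
  \<open>a + b \<le> n - 2\<close>.  The coverings thus correspond to pairs \<open>(A, B)\<close> of subsets of \<open>{1..n - 2}\<close> with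
  this property for all \<open>a \<in> A\<close> and \<open>b \<in> B\<close>, and the vertical dominoes number \<open>\<Sum>A + \<Sum>B\<close>.
  At most one of the two sets has an element above \<open>(n - 2) div 2\<close>.  If the largest such element is
  \<open>n - i - 1\<close>, the rest of its set is any subset of \<open>{1..n - i - 2}\<close> and the other set any subset of
  \<open>{1..i - 1}\<close>; if there is none, both sets are arbitrary up to \<open>(n - 2) div 2\<close>.  These are the terms
  of \<open>W_poly\<close> (\<open>W_poly_admissible\<close>).
\<close>

section \<open>Coverings read locally\<close>

lemma covering_unique:
  assumes "covering n T" "t \<in> T" "u \<in> T" "x \<in> cells t" "x \<in> cells u"
  shows "t = u"
  using assms unfolding covering_def by blast

lemma covering_in_grid:
  assumes "covering n T" "t \<in> T"
  shows "cells t \<subseteq> {0..<n} \<times> {0..<n}"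
  using assms unfolding covering_def by blast

lemma covering_HDom: "covering n T \<Longrightarrow> HDom r c \<in> T \<Longrightarrow> r < n \<and> Suc c < n"
  using covering_in_grid[of n T "HDom r c"] by simp

lemma covering_VDom: "covering n T \<Longrightarrow> VDom r c \<in> T \<Longrightarrow> Suc r < n \<and> c < n"
  using covering_in_grid[of n T "VDom r c"] by simp

lemma covering_Mono: "covering n T \<Longrightarrow> Mono r c \<in> T \<Longrightarrow> r < n \<and> c < n"
  using covering_in_grid[of n T "Mono r c"] by simp

lemma in_cells_iff:
  "(r, c) \<in> cells t \<longleftrightarrow>
     t = Mono r c \<or> t = HDom r c \<or> t = VDom r c \<or>
     (\<exists>c'. c = Suc c' \<and> t = HDom r c') \<or> (\<exists>r'. r = Suc r' \<and> t = VDom r' c)"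
  by (cases t) auto

lemma covering_cell:
  assumes "covering n T" "r < n" "c < n"
  shows "Mono r c \<in> T \<or> HDom r c \<in> T \<or> VDom r c \<in> T \<or>
     (\<exists>c'. c = Suc c' \<and> HDom r c' \<in> T) \<or> (\<exists>r'. r = Suc r' \<and> VDom r' c \<in> T)"
proof -
  have "(r, c) \<in> (\<Union>t\<in>T. cells t)"
    using assms unfolding covering_def by auto
  then obtain t where "t \<in> T" "(r, c) \<in> cells t" by blast
  then show ?thesis unfolding in_cells_iff by blast
qed

lemma finite_cells [simp]: "finite (cells t)"
  by (cases t) auto

lemma covering_finite:
  assumes "covering n T"
  shows "finite T"
proof (rule finite_imageD)
  have "cells ` T \<subseteq> Pow ({0..<n} \<times> {0..<n})"
    using covering_in_grid[OF assms] by blast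
  then show "finite (cells ` T)"
    by (rule finite_subset) simp
  show "inj_on cells T"
  proof (rule inj_onI)
    fix t u assume tu: "t \<in> T" "u \<in> T" "cells t = cells u"
    obtain x where "x \<in> cells t" by (cases t) auto
    with tu show "t = u" using covering_unique[OF assms, of t u x] by simp
  qed
qed

lemma corner_cell:
  assumes "(i, j) \<in> corners t"
  shows "\<exists>x\<in>cells t. fst x \<in> {i - 1, i} \<and> snd x \<in> {j - 1, j}"
  using assms by (cases t) auto

lemma card_four: "distinct [a, b, c, d] \<Longrightarrow> card {a, b, c, d} = 4"
  by simp

lemma card_2_le: "card {a, b} \<le> 2"
  using card_length[of "[a, b]"] by simp

lemma card_4_le: "card {a, b, c, d} \<le> 4"
  using card_length[of "[a, b, c, d]"] by simp

text \<open>A tile with a corner at a point covers exactly one of the four cells around that point.  So four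
tiles meet there if and only if the four cells belong to four tiles, which a domino covering two of
them prevents.\<close>

lemma tatami_iff_block:
  assumes cov: "covering n T"
  shows "\<not> four_tiles_meet T \<longleftrightarrow>
    (\<forall>r c. Suc r < n \<longrightarrow> Suc c < n \<longrightarrow>
       HDom r c \<in> T \<or> HDom (Suc r) c \<in> T \<or> VDom r c \<in> T \<or> VDom r (Suc c) \<in> T)"
    (is "_ \<longleftrightarrow> ?B")
proof
  assume nf: "\<not> four_tiles_meet T"
  show ?B
  proof (intro allI impI, rule ccontr)
    fix r c
    assume rc: "Suc r < n" "Suc c < n"
      and no: "\<not> (HDom r c \<in> T \<or> HDom (Suc r) c \<in> T \<or> VDom r c \<in> T \<or> VDom r (Suc c) \<in> T)"
    have ex: "\<exists>t\<in>T. x \<in> cells t" if "x \<in> {0..<n} \<times> {0..<n}" for x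
      using cov that unfolding covering_def by blast
    obtain t1 where t1: "t1 \<in> T" "(r, c) \<in> cells t1" using ex[of "(r, c)"] rc by auto
    obtain t2 where t2: "t2 \<in> T" "(r, Suc c) \<in> cells t2" using ex[of "(r, Suc c)"] rc by auto
    obtain t3 where t3: "t3 \<in> T" "(Suc r, c) \<in> cells t3" using ex[of "(Suc r, c)"] rc by auto
    obtain t4 where t4: "t4 \<in> T" "(Suc r, Suc c) \<in> cells t4"
      using ex[of "(Suc r, Suc c)"] rc by auto
    have 1: "(Suc r, Suc c) \<in> corners t1 \<and> (r, Suc c) \<notin> cells t1 \<and> (Suc r, c) \<notin> cells t1
        \<and> (Suc r, Suc c) \<notin> cells t1"
      using t1 no by (cases t1) auto
    have 2: "(Suc r, Suc c) \<in> corners t2 \<and> (Suc r, c) \<notin> cells t2 \<and> (Suc r, Suc c) \<notin> cells t2"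
      using t2 no by (cases t2) auto
    have 3: "(Suc r, Suc c) \<in> corners t3 \<and> (Suc r, Suc c) \<notin> cells t3"
      using t3 no by (cases t3) auto
    have 4: "(Suc r, Suc c) \<in> corners t4"
      using t4 no by (cases t4) auto
    have "card {t1, t2, t3, t4} = 4"
      by (rule card_four) (use 1 2 3 t2 t3 t4 in auto)
    then have "four_tiles_meet T"
      unfolding four_tiles_meet_def using 1 2 3 4 t1 t2 t3 t4
      by (intro exI[of _ "(Suc r, Suc c)"] exI[of _ "{t1, t2, t3, t4}"]) auto
    with nf show False ..
  qed
next
  assume B: ?B
  show "\<not> four_tiles_meet T"
  proof
    assume "four_tiles_meet T"
    then obtain i j F where F: "F \<subseteq> T" "card F = 4" "\<forall>t\<in>F. (i, j) \<in> corners t"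
      unfolding four_tiles_meet_def by auto
    \<comment> \<open>The map \<open>g\<close> below sends the four tiles injectively to cells around the point, and at most three
      such cells are available: on the boundary because some are missing, inside because the
      domino of the block covers two of them without having the point as a corner.\<close>
    define X where "X = {x \<in> {0..<n} \<times> {0..<n}. fst x \<in> {i - 1, i} \<and> snd x \<in> {j - 1, j} \<and>
      (\<exists>t\<in>T. x \<in> cells t \<and> (i, j) \<in> corners t)}"
    have ex: "\<exists>x. x \<in> cells t \<and> x \<in> X" if "t \<in> F" for t
    proof -
      have t: "t \<in> T" "(i, j) \<in> corners t" using that F by auto
      obtain x where x: "x \<in> cells t" "fst x \<in> {i - 1, i}" "snd x \<in> {j - 1, j}"
        using corner_cell[OF t(2)] by blast
      moreover have "x \<in> {0..<n} \<times> {0..<n}"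
        using covering_in_grid[OF cov t(1)] x(1) by blast
      ultimately have "x \<in> X"
        unfolding X_def using t by blast
      with x(1) show ?thesis by blast
    qed
    then have "\<forall>t\<in>F. \<exists>x. x \<in> cells t \<and> x \<in> X" by blast
    from bchoice[OF this] obtain g where g: "\<And>t. t \<in> F \<Longrightarrow> g t \<in> cells t \<and> g t \<in> X"
      by blast
    have inj: "inj_on g F"
    proof (rule inj_onI)
      fix t u assume "t \<in> F" "u \<in> F" "g t = g u"
      then show "t = u"
        using covering_unique[OF cov, of t u "g t"] g[of t] g[of u] F(1) by auto
    qed
    have sub: "X \<subseteq> {(i - 1, j - 1), (i - 1, j), (i, j - 1), (i, j)}"
      unfolding X_def by auto
    then have finX: "finite X" by (rule finite_subset) simp
    have ne: "X \<noteq> {(i - 1, j - 1), (i - 1, j), (i, j - 1), (i, j)} \<or> i = 0 \<or> j = 0"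
    proof (rule ccontr)
      assume "\<not> ?thesis"
      then have eq: "X = {(i - 1, j - 1), (i - 1, j), (i, j - 1), (i, j)}" and "i \<noteq> 0" "j \<noteq> 0"
        by auto
      then obtain r c where rc: "i = Suc r" "j = Suc c" by (metis not0_implies_Suc)
      have all: "(r, c) \<in> X" "(r, Suc c) \<in> X" "(Suc r, c) \<in> X" "(Suc r, Suc c) \<in> X"
        using eq rc by auto
      then have "Suc r < n" "Suc c < n" unfolding X_def by auto
      with B obtain d where d: "d \<in> T" "d \<in> {HDom r c, HDom (Suc r) c, VDom r c, VDom r (Suc c)}"
        by blast
      have nc: "(i, j) \<notin> corners d" using d rc by auto
      obtain x where x: "x \<in> X" "x \<in> cells d" using d all by auto
      then obtain t where "t \<in> T" "x \<in> cells t" "(i, j) \<in> corners t"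
        unfolding X_def by blast
      with x(2) d(1) nc show False
        using covering_unique[OF cov, of t d x] by simp
    qed
    have "card X < 4"
    proof (cases "i = 0 \<or> j = 0")
      case True
      then have "card X \<le> 2"
      proof
        assume "i = 0"
        then have "{(i - 1, j - 1), (i - 1, j), (i, j - 1), (i, j)} = {(i, j - 1), (i, j)}"
          by auto
        with sub have "X \<subseteq> {(i, j - 1), (i, j)}" by simp
        from card_mono[OF _ this] show ?thesis using card_2_le[of "(i, j - 1)" "(i, j)"] by simp
      next
        assume "j = 0"
        then have "{(i - 1, j - 1), (i - 1, j), (i, j - 1), (i, j)} = {(i - 1, j), (i, j)}"
          by auto
        with sub have "X \<subseteq> {(i - 1, j), (i, j)}" by simp
        from card_mono[OF _ this] show ?thesis using card_2_le[of "(i - 1, j)" "(i, j)"] by simp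
      qed
      then show ?thesis by simp
    next
      case False
      with ne sub have "X \<subset> {(i - 1, j - 1), (i - 1, j), (i, j - 1), (i, j)}" by blast
      then have "card X < card {(i - 1, j - 1), (i - 1, j), (i, j - 1), (i, j)}"
        by (rule psubset_card_mono[rotated]) simp
      also have "\<dots> \<le> 4"
        by (rule card_4_le)
      finally show ?thesis .
    qed
    moreover have "card F \<le> card X"
      by (rule card_inj_on_le[of g]) (use inj g finX in blast)+
    ultimately show False using F(2) by simp
  qed
qed

section \<open>A weighted count of the monominoes\<close>

text \<open>The doubled pyramid of the introduction, at the vertices and at the centres of the cells.  The
centre of a cell in row \<open>r\<close> is at distance \<open>r + 1/2\<close> from the top, hence the 1 in \<open>cell_height\<close>.\<close>

definition vertex_height :: "nat \<Rightarrow> nat \<times> nat \<Rightarrow> nat" where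
  "vertex_height n = (\<lambda>(i, j). 2 * min (min i (n - i)) (min j (n - j)))"

definition cell_height :: "nat \<Rightarrow> nat \<times> nat \<Rightarrow> nat" where
  "cell_height n = (\<lambda>(r, c). 2 * min (min r (n - 1 - r)) (min c (n - 1 - c)) + 1)"

text \<open>The ends of the edge that joins the two halves of a domino.\<close>

fun seam :: "tile \<Rightarrow> (nat \<times> nat) set" where
  "seam (Mono r c) = {}"
| "seam (HDom r c) = {(r, Suc c), (Suc r, Suc c)}"
| "seam (VDom r c) = {(Suc r, c), (Suc r, Suc c)}"

lemma finite_seam [simp]: "finite (seam t)"
  by (cases t) auto

text \<open>The distance to the nearer of two opposite sides changes by one between consecutive grid lines,
except across the middle row of a square of odd side.\<close>

lemma depth_step:
  fixes r n :: nat
  assumes "r < n"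
  shows "(min r (n - r) = min r (n - 1 - r) \<and> min (Suc r) (n - Suc r) = Suc (min r (n - 1 - r)) \<and> r < n - 1 - r)
    \<or> (min r (n - r) = min r (n - 1 - r) \<and> min (Suc r) (n - Suc r) = min r (n - 1 - r) \<and> r = n - 1 - r)
    \<or> (min r (n - r) = Suc (min r (n - 1 - r)) \<and> min (Suc r) (n - Suc r) = min r (n - 1 - r) \<and> r > n - 1 - r)"
proof -
  obtain a where n: "n = Suc (r + a)" using assms less_iff_Suc_add by auto
  have d: "n - r = Suc a" "n - 1 - r = a" "n - Suc r = a" unfolding n by simp_all
  show ?thesis unfolding d by (cases r a rule: linorder_cases) simp_all
qed

lemma min_same_iff:
  fixes r c n :: nat
  assumes "r < n" "c < n"
  shows "min r (n - 1 - r) = min c (n - 1 - c) \<longleftrightarrow> r = c \<or> r + c = n - 1"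
proof -
  obtain a where a: "n = Suc (r + a)" using assms(1) less_iff_Suc_add by auto
  obtain b where b: "n = Suc (c + b)" using assms(2) less_iff_Suc_add by auto
  have d: "n - 1 - r = a" "n - 1 - c = b" "n - 1 = r + a" "r + a = c + b" using a b by simp_all
  show ?thesis
    unfolding d(1,2,3) using d(4)
    by (cases "r \<le> a"; cases "c \<le> b"; simp add: min_def; linarith)
qed

text \<open>Off the two diagonals of the square the pyramid is affine on a cell, and the centre has the mean
height of the corners.  Each diagonal through the cell is a ridge and lifts the centre by one half
above that mean.\<close>

lemma cell_height_corners:
  assumes "r < n" "c < n"
  shows "4 * cell_height n (r, c) =
    vertex_height n (r, c) + vertex_height n (r, Suc c) + vertex_height n (Suc r, c) +
    vertex_height n (Suc r, Suc c) + (if r = c then 2 else 0) + (if r + c = n - 1 then 2 else 0)"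
proof -
  define p i0 i1 where "p = min r (n - 1 - r)" and "i0 = min r (n - r)"
    and "i1 = min (Suc r) (n - Suc r)"
  define q j0 j1 where "q = min c (n - 1 - c)" and "j0 = min c (n - c)"
    and "j1 = min (Suc c) (n - Suc c)"
  note defs = p_def i0_def i1_def q_def j0_def j1_def
  have z: "cell_height n (r, c) = 2 * min p q + 1"
    unfolding cell_height_def defs by simp
  have y: "vertex_height n (r, c) = 2 * min i0 j0" "vertex_height n (r, Suc c) = 2 * min i0 j1"
    "vertex_height n (Suc r, c) = 2 * min i1 j0" "vertex_height n (Suc r, Suc c) = 2 * min i1 j1"
    unfolding vertex_height_def defs by simp_all
  have pq: "p = q \<longleftrightarrow> r = c \<or> r + c = n - 1"
    unfolding p_def q_def by (rule min_same_iff[OF assms])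
  obtain a where a: "n = Suc (r + a)" using assms(1) less_iff_Suc_add by auto
  obtain b where b: "n = Suc (c + b)" using assms(2) less_iff_Suc_add by auto
  have d: "n - 1 - r = a" "n - 1 - c = b" "r + a = c + b" "n - 1 = r + a" using a b by simp_all
  have mid: "r = a \<Longrightarrow> q \<le> p" "c = b \<Longrightarrow> p \<le> q" "r = a \<Longrightarrow> p = q \<Longrightarrow> r = c"
    "c = b \<Longrightarrow> p = q \<Longrightarrow> r = c" "r = c \<Longrightarrow> r + c = n - 1 \<longleftrightarrow> r = a"
    unfolding p_def q_def d(1,2,4) using d(3) by linarith+
  have I: "i0 = p \<and> i1 = Suc p \<and> r \<noteq> a \<or> i0 = Suc p \<and> i1 = p \<and> r \<noteq> a
      \<or> i0 = p \<and> i1 = p \<and> r = a"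
    using depth_step[OF assms(1)] unfolding defs d(1) by auto
  have J: "j0 = q \<and> j1 = Suc q \<and> c \<noteq> b \<or> j0 = Suc q \<and> j1 = q \<and> c \<noteq> b
      \<or> j0 = q \<and> j1 = q \<and> c = b"
    using depth_step[OF assms(2)] unfolding defs d(2) by auto
  have ab: "r = c \<Longrightarrow> r = a \<longleftrightarrow> c = b" using d(3) by simp
  consider "p < q" "r \<noteq> c" "r + c \<noteq> n - 1" "r \<noteq> a"
    | "q < p" "r \<noteq> c" "r + c \<noteq> n - 1" "c \<noteq> b"
    | "p = q" "r = c" "r + c \<noteq> n - 1" "r \<noteq> a" "c \<noteq> b"
    | "p = q" "r \<noteq> c" "r + c = n - 1" "r \<noteq> a" "c \<noteq> b"
    | "p = q" "r = c" "r + c = n - 1" "r = a" "c = b"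
  proof -
    have "p < q \<or> q < p \<or> p = q" "p < q \<Longrightarrow> \<not> q \<le> p" "q < p \<Longrightarrow> \<not> p \<le> q"
      "p < q \<Longrightarrow> p \<noteq> q" "q < p \<Longrightarrow> p \<noteq> q" by auto
    then show thesis using pq mid ab that by blast
  qed
  then show ?thesis
  proof cases
    case 1
    with I J show ?thesis unfolding z y by (elim disjE conjE) simp_all
  next
    case 2
    with I J show ?thesis unfolding z y by (elim disjE conjE) simp_all
  next
    case 3
    with I J show ?thesis unfolding z y by (elim disjE conjE) simp_all
  next
    case 4
    with I J show ?thesis unfolding z y by (elim disjE conjE) simp_all
  next
    case 5
    with I J show ?thesis unfolding z y by (elim disjE conjE) simp_all
  qed
qed

text \<open>The two cell centres of a domino and the two ends of its seam are the opposite corners of a small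
square that stands on its tip.  The lines containing its sides have integer intercepts, as have the
ridges of the pyramid, so no ridge crosses its interior, the pyramid is affine on it, and both pairs
of opposite corners have the same sum.\<close>

lemma height_VDom:
  assumes "Suc s < n" "c < n"
  shows "cell_height n (s, c) + cell_height n (Suc s, c) =
    vertex_height n (Suc s, c) + vertex_height n (Suc s, Suc c)"
proof -
  define p where "p = min (Suc s) (n - Suc s)"
  define q where "q = min c (n - 1 - c)"
  have z: "cell_height n (i, c) = 2 * min (min i (n - 1 - i)) q + 1" for i
    unfolding cell_height_def q_def by simp
  have y: "vertex_height n (Suc s, j) = 2 * min p (min j (n - j))" for j
    unfolding vertex_height_def p_def by simp
  define j0 j1 where "j0 = min c (n - c)" and "j1 = min (Suc c) (n - Suc c)"
  obtain a where n: "n = Suc (Suc (s + a))" using assms(1) less_iff_Suc_add by auto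
  have i: "n - 1 - Suc s = a" "n - 1 - s = Suc a" and p: "p = min (Suc s) (Suc a)"
    unfolding p_def n by simp_all
  obtain b where b: "n = Suc (c + b)" using assms(2) less_iff_Suc_add by auto
  have d: "n - 1 - c = b" "s + a + 1 = c + b" using n b by simp_all
  have q: "2 * q \<le> s + a + 1" "c = b \<Longrightarrow> s + a + 1 = 2 * q"
    unfolding q_def d(1) using d(2) by linarith+
  have J: "j0 = q \<and> j1 = Suc q \<and> c \<noteq> b \<or> j0 = Suc q \<and> j1 = q \<and> c \<noteq> b
      \<or> j0 = q \<and> j1 = q \<and> s + a + 1 = 2 * q"
    using depth_step[OF assms(2)] q(2) unfolding j0_def j1_def q_def d(1) by auto
  have st: "s < a \<and> min (Suc s) a = Suc s \<and> min s (Suc a) = s \<and> p = Suc s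
    \<or> s = a \<and> min (Suc s) a = s \<and> min s (Suc a) = s \<and> p = Suc s
    \<or> a < s \<and> min (Suc s) a = a \<and> min s (Suc a) = Suc a \<and> p = Suc a"
    unfolding p by (cases s a rule: linorder_cases) simp_all
  have "min (min (Suc s) a) q + min (min s (Suc a)) q + 1 = min p j0 + min p j1"
    using st
  proof (elim disjE conjE)
    assume "s < a" and m: "min (Suc s) a = Suc s" "min s (Suc a) = s" "p = Suc s"
    show ?thesis
      unfolding m using J \<open>s < a\<close>
      by (cases "q \<le> s"; cases "q = Suc s"; elim disjE conjE; simp add: min_absorb1 min_absorb2)
  next
    assume "s = a" and m: "min (Suc s) a = s" "min s (Suc a) = s" "p = Suc s"
    then have "q \<le> s" using q(1) by simp
    then show ?thesis
      unfolding m using J \<open>s = a\<close>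
      by (elim disjE conjE; simp add: min_absorb1 min_absorb2)
  next
    assume "a < s" and m: "min (Suc s) a = a" "min s (Suc a) = Suc a" "p = Suc a"
    show ?thesis
      unfolding m using J \<open>a < s\<close>
      by (cases "q \<le> a"; cases "q = Suc a"; elim disjE conjE; simp add: min_absorb1 min_absorb2)
  qed
  then show ?thesis
    unfolding z y i j0_def j1_def by simp
qed

lemma height_HDom:
  assumes "r < n" "Suc c < n"
  shows "cell_height n (r, c) + cell_height n (r, Suc c) =
    vertex_height n (r, Suc c) + vertex_height n (Suc r, Suc c)"
proof -
  have "cell_height n (i, j) = cell_height n (j, i)" "vertex_height n (i, j) = vertex_height n (j, i)" for i j
    unfolding cell_height_def vertex_height_def by (simp_all add: min.commute)
  then show ?thesis using height_VDom[OF assms(2,1)] by metis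
qed

lemma sum_shift_zero:
  fixes g :: "nat \<Rightarrow> nat"
  assumes "g 0 = 0" "g n = 0"
  shows "(\<Sum>i = 0..<n. g (Suc i)) = (\<Sum>i = 0..<n. g i)"
proof -
  have "g 0 + (\<Sum>i = 0..<n. g (Suc i)) = (\<Sum>i = 0..<n. g i) + g n"
    using sum.lessThan_Suc_shift[of g n] sum.lessThan_Suc[of g n] by (simp add: atLeast0LessThan)
  then show ?thesis using assms by simp
qed

lemma vertex_height_zero:
  "i \<ge> n \<Longrightarrow> vertex_height n (i, j) = 0" "j \<ge> n \<Longrightarrow> vertex_height n (i, j) = 0"
  "vertex_height n (0, j) = 0" "vertex_height n (i, 0) = 0"
  unfolding vertex_height_def by simp_all

lemma vertex_height_pos:
  "0 < i \<Longrightarrow> i < n \<Longrightarrow> 0 < j \<Longrightarrow> j < n \<Longrightarrow> 0 < vertex_height n (i, j)"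
  unfolding vertex_height_def by simp

text \<open>Summing \<open>cell_height_corners\<close>: an inner vertex is a corner of four cells, vertices on the boundary
have height 0, and each of the two diagonals contains \<open>n\<close> cells.\<close>

lemma total_height:
  "(\<Sum>x\<in>{0..<n} \<times> {0..<n}. cell_height n x) = (\<Sum>v\<in>{0..<n} \<times> {0..<n}. vertex_height n v) + n"
proof -
  let ?y = "vertex_height n"
  let ?Y = "\<Sum>r = 0..<n. \<Sum>c = 0..<n. ?y (r, c)"
  have s: "(\<Sum>c = 0..<n. ?y (r, Suc c)) = (\<Sum>c = 0..<n. ?y (r, c))" for r
    by (rule sum_shift_zero) (simp_all add: vertex_height_zero)
  have t: "(\<Sum>r = 0..<n. \<Sum>c = 0..<n. ?y (Suc r, c)) = ?Y"
    by (rule sum_shift_zero) (simp_all add: vertex_height_zero)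
  have d1: "(\<Sum>r = 0..<n. \<Sum>c = 0..<n. if r = c then 2 else 0) = 2 * n"
    by simp
  have "(\<Sum>c = 0..<n. if r + c = n - 1 then 2 else 0) = (2::nat)" if "r < n" for r
  proof -
    have "r + c = n - 1 \<longleftrightarrow> c = n - 1 - r" if "c \<in> {0..<n}" for c using that \<open>r < n\<close> by auto
    then have "(\<Sum>c = 0..<n. if r + c = n - 1 then 2 else 0)
        = (\<Sum>c = 0..<n. if c = n - 1 - r then 2 else (0::nat))"
      by (intro sum.cong) simp_all
    then show ?thesis using that by simp
  qed
  then have d2: "(\<Sum>r = 0..<n. \<Sum>c = 0..<n. if r + c = n - 1 then 2 else 0) = 2 * n"
    by (simp add: sum.cong[of "{0..<n}" "{0..<n}" _ "\<lambda>_. 2"])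
  have "4 * (\<Sum>r = 0..<n. \<Sum>c = 0..<n. cell_height n (r, c)) =
    (\<Sum>r = 0..<n. \<Sum>c = 0..<n. ?y (r, c) + ?y (r, Suc c) + ?y (Suc r, c) + ?y (Suc r, Suc c)
      + (if r = c then 2 else 0) + (if r + c = n - 1 then 2 else 0))"
    unfolding sum_distrib_left by (intro sum.cong refl cell_height_corners) simp_all
  also have "\<dots> = ?Y + ?Y + ?Y + ?Y + 2 * n + 2 * n"
    unfolding sum.distrib d1 d2 s t ..
  finally show ?thesis by (simp add: sum.cartesian_product)
qed

lemma sum_cells_tile:
  assumes "covering n T" "t \<in> T"
  shows "(\<Sum>x\<in>cells t. cell_height n x) =
    (if is_mono t then \<Sum>x\<in>cells t. cell_height n x else 0) + (\<Sum>v\<in>seam t. vertex_height n v)"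
proof (cases t)
  case (HDom r c)
  then show ?thesis using covering_HDom assms height_HDom by simp
next
  case (VDom r c)
  then show ?thesis using covering_VDom assms height_VDom by simp
qed simp

text \<open>The total height of the cells is collected tile by tile; the contribution of a domino is moved to the
ends of its seam.\<close>

lemma weighted_mono_count:
  assumes cov: "covering n T"
  shows "(\<Sum>t\<in>{t \<in> T. is_mono t}. \<Sum>x\<in>cells t. cell_height n x) +
      (\<Sum>v\<in>{0..<n} \<times> {0..<n}. vertex_height n v * card {t \<in> T. v \<in> seam t}) =
    (\<Sum>v\<in>{0..<n} \<times> {0..<n}. vertex_height n v) + n"
proof -
  let ?G = "{0..<n} \<times> {0..<n}" and ?y = "vertex_height n" and ?z = "cell_height n"
  note fin = covering_finite[OF cov]
  have out: "?y v = 0" if "v \<notin> ?G" for v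
    using that by (cases v) (auto simp: vertex_height_zero not_less)
  have seam: "(\<Sum>v\<in>seam t. ?y v) = (\<Sum>v\<in>?G. if v \<in> seam t then ?y v else 0)" for t
  proof -
    have "(\<Sum>v\<in>seam t. ?y v) = (\<Sum>v\<in>?G \<inter> seam t. ?y v)"
    proof (rule sum.mono_neutral_right)
      show "\<forall>v\<in>seam t - ?G \<inter> seam t. ?y v = 0"
        using out by blast
    qed auto
    then show ?thesis by (simp add: sum.inter_restrict)
  qed
  have "(\<Sum>v\<in>?G. ?y v) + n = (\<Sum>x\<in>(\<Union>t\<in>T. cells t). ?z x)"
    using cov total_height unfolding covering_def by simp
  also have "\<dots> = (\<Sum>t\<in>T. \<Sum>x\<in>cells t. ?z x)"
    using cov fin unfolding covering_def by (intro sum.UNION_disjoint) auto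
  also have "\<dots> = (\<Sum>t\<in>T. (if is_mono t then \<Sum>x\<in>cells t. ?z x else 0) + (\<Sum>v\<in>seam t. ?y v))"
    using sum_cells_tile[OF cov] by (intro sum.cong) simp_all
  also have "\<dots> = (\<Sum>t\<in>T. if is_mono t then \<Sum>x\<in>cells t. ?z x else 0) +
      (\<Sum>v\<in>?G. \<Sum>t\<in>T. if v \<in> seam t then ?y v else 0)"
    unfolding sum.distrib seam by (subst (2) sum.swap) simp
  also have "(\<Sum>t\<in>T. if is_mono t then \<Sum>x\<in>cells t. ?z x else 0) =
      (\<Sum>t\<in>{t \<in> T. is_mono t}. \<Sum>x\<in>cells t. ?z x)"
    using fin by (simp add: sum.inter_filter)
  also have "(\<Sum>v\<in>?G. \<Sum>t\<in>T. if v \<in> seam t then ?y v else 0) =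
      (\<Sum>v\<in>?G. ?y v * card {t \<in> T. v \<in> seam t})"
    using fin by (intro sum.cong refl) (simp add: sum.inter_filter[symmetric])
  finally show ?thesis by simp
qed

text \<open>The equality case of the weighted count: in every block some domino has an end of its seam
at the centre, no vertex lies on the seams of two parallel dominoes, and all monominoes lie on the
boundary.\<close>

definition perfect :: "nat \<Rightarrow> tile set \<Rightarrow> bool" where
  "perfect n T \<longleftrightarrow> covering n T \<and>
     (\<forall>r c. Suc r < n \<longrightarrow> Suc c < n \<longrightarrow>
       HDom r c \<in> T \<or> HDom (Suc r) c \<in> T \<or> VDom r c \<in> T \<or> VDom r (Suc c) \<in> T) \<and>
     (\<forall>r c. \<not> (HDom r c \<in> T \<and> HDom (Suc r) c \<in> T)) \<and>
     (\<forall>r c. \<not> (VDom r c \<in> T \<and> VDom r (Suc c) \<in> T)) \<and>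
     (\<forall>r c. Mono r c \<in> T \<longrightarrow> r = 0 \<or> c = 0 \<or> Suc r = n \<or> Suc c = n)"

lemma in_seam_iff:
  "(Suc r, Suc c) \<in> seam t \<longleftrightarrow>
    t = HDom r c \<or> t = HDom (Suc r) c \<or> t = VDom r c \<or> t = VDom r (Suc c)"
  by (cases t) auto

lemma perfect_seam:
  assumes "perfect n T" "Suc r < n" "Suc c < n"
  shows "card {t \<in> T. (Suc r, Suc c) \<in> seam t} = 1"
proof -
  have cov: "covering n T" using assms(1) unfolding perfect_def by blast
  obtain t where t: "t \<in> T" "(Suc r, Suc c) \<in> seam t"
    using assms unfolding perfect_def in_seam_iff by metis
  have "u = t" if u: "u \<in> T" "(Suc r, Suc c) \<in> seam u" for u
  proof (rule ccontr)
    assume "u \<noteq> t"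
    then have dj: "cells u \<inter> cells t = {}" using covering_unique[OF cov u(1) t(1)] by blast
    have "\<not> (HDom r c \<in> T \<and> HDom (Suc r) c \<in> T)" "\<not> (VDom r c \<in> T \<and> VDom r (Suc c) \<in> T)"
      using assms(1) unfolding perfect_def by blast+
    with t u dj \<open>u \<noteq> t\<close> show False unfolding in_seam_iff by auto
  qed
  with t have "{t \<in> T. (Suc r, Suc c) \<in> seam t} = {t}" by blast
  then show ?thesis by simp
qed

text \<open>In \<open>weighted_mono_count\<close> every monomino has weight at least 1 and every inner vertex of a tatami
covering lies on at least one seam.  So there are \<open>n\<close> monominoes if and only if all these estimates
are equalities.\<close>

lemma perfect_iff_tatami:
  "perfect n T \<longleftrightarrow> tatami_covering n T \<and> card {t \<in> T. is_mono t} = n"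
proof (cases "tatami_covering n T")
  case False
  then show ?thesis unfolding tatami_covering_def perfect_def using tatami_iff_block by blast
next
  case True
  then have cov: "covering n T" and block: "\<And>r c. Suc r < n \<Longrightarrow> Suc c < n \<Longrightarrow>
      HDom r c \<in> T \<or> HDom (Suc r) c \<in> T \<or> VDom r c \<in> T \<or> VDom r (Suc c) \<in> T"
    unfolding tatami_covering_def using tatami_iff_block by blast+
  let ?G = "{0..<n} \<times> {0..<n}" and ?y = "vertex_height n" and ?z = "cell_height n"
  let ?M = "{t \<in> T. is_mono t}" and ?k = "\<lambda>v. card {t \<in> T. v \<in> seam t}"
  note fin = covering_finite[OF cov]
  have finM: "finite ?M" using fin by simp
  note count = weighted_mono_count[OF cov]
  have z1: "1 \<le> (\<Sum>x\<in>cells t. ?z x)" if "t \<in> ?M" for t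
    using that by (cases t) (auto simp: cell_height_def)
  have y1: "?y v \<le> ?y v * ?k v" if "v \<in> ?G" for v
  proof (cases "fst v = 0 \<or> snd v = 0")
    case True
    then show ?thesis by (cases v) (auto simp: vertex_height_zero)
  next
    case False
    then obtain r c where v: "v = (Suc r, Suc c)"
      by (metis not0_implies_Suc prod.collapse)
    have "{t \<in> T. v \<in> seam t} \<noteq> {}"
      using block[of r c] that unfolding v in_seam_iff by auto
    then have "?k v \<noteq> 0" using fin by simp
    then show ?thesis by simp
  qed
  show ?thesis
  proof
    assume "perfect n T"
    have "(\<Sum>t\<in>?M. \<Sum>x\<in>cells t. ?z x) = (\<Sum>t\<in>?M. 1)"
    proof (rule sum.cong)
      fix t assume t: "t \<in> ?M"
      then obtain r c where m: "t = Mono r c" by (cases t) auto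
      with t \<open>perfect n T\<close> have "r = 0 \<or> c = 0 \<or> Suc r = n \<or> Suc c = n"
        unfolding perfect_def by blast
      then show "(\<Sum>x\<in>cells t. ?z x) = 1" unfolding m cell_height_def by auto
    qed simp
    moreover have "(\<Sum>v\<in>?G. ?y v * ?k v) = (\<Sum>v\<in>?G. ?y v)"
    proof (rule sum.cong)
      fix v assume v: "v \<in> ?G"
      obtain i j where ij: "v = (i, j)" by (cases v)
      show "?y v * ?k v = ?y v"
      proof (cases "i = 0 \<or> j = 0")
        case True
        then show ?thesis unfolding ij by (auto simp: vertex_height_zero)
      next
        case False
        then obtain r c where "v = (Suc r, Suc c)" unfolding ij by (metis not0_implies_Suc)
        with v perfect_seam[OF \<open>perfect n T\<close>, of r c] show ?thesis by simp
      qed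
    qed simp
    ultimately have "card ?M = n" using count by simp
    with True show "tatami_covering n T \<and> card ?M = n" ..
  next
    assume "tatami_covering n T \<and> card ?M = n"
    then have M: "(\<Sum>t\<in>?M. 1) = n" by simp
    have "(\<Sum>t\<in>?M. 1) \<le> (\<Sum>t\<in>?M. \<Sum>x\<in>cells t. ?z x)" "(\<Sum>v\<in>?G. ?y v) \<le> (\<Sum>v\<in>?G. ?y v * ?k v)"
      using z1 y1 by (intro sum_mono; blast)+
    with count M have eq: "(\<Sum>t\<in>?M. 1) = (\<Sum>t\<in>?M. \<Sum>x\<in>cells t. ?z x)"
      "(\<Sum>v\<in>?G. ?y v) = (\<Sum>v\<in>?G. ?y v * ?k v)" by linarith+
    have zz: "1 = (\<Sum>x\<in>cells t. ?z x)" if "t \<in> ?M" for t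
      by (rule sum_mono_inv[OF eq(1)]) (use that z1 finM in auto)
    have yy: "?y v = ?y v * ?k v" if "v \<in> ?G" for v
      by (rule sum_mono_inv[OF eq(2)]) (use that y1 in auto)
    have k1: "?k (Suc r, Suc c) = 1" if "Suc r < n" "Suc c < n" for r c
      using yy[of "(Suc r, Suc c)"] vertex_height_pos[of "Suc r" n "Suc c"] that by simp
    have uniq: "t = u" if "(Suc r, Suc c) \<in> seam t" "(Suc r, Suc c) \<in> seam u" "t \<in> T" "u \<in> T"
      and rc: "Suc r < n" "Suc c < n" for r c t u
    proof -
      obtain w where "{t \<in> T. (Suc r, Suc c) \<in> seam t} = {w}"
        using k1[OF rc] by (rule card_1_singletonE)
      then have "\<And>x. x \<in> T \<Longrightarrow> (Suc r, Suc c) \<in> seam x \<Longrightarrow> x = w" by blast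
      then show ?thesis using that by metis
    qed
    have "\<not> (HDom r c \<in> T \<and> HDom (Suc r) c \<in> T)" for r c
      using uniq[of r c "HDom r c" "HDom (Suc r) c"] covering_HDom[OF cov, of "Suc r" c] by auto
    moreover have "\<not> (VDom r c \<in> T \<and> VDom r (Suc c) \<in> T)" for r c
      using uniq[of r c "VDom r c" "VDom r (Suc c)"] covering_VDom[OF cov, of r "Suc c"] by auto
    moreover have "r = 0 \<or> c = 0 \<or> Suc r = n \<or> Suc c = n" if m: "Mono r c \<in> T" for r c
    proof -
      have "?z (r, c) = 1" using zz[of "Mono r c"] m by simp
      with covering_Mono[OF cov m] show ?thesis unfolding cell_height_def by (auto simp: min_def split: if_splits)
    qed
    ultimately show "perfect n T" unfolding perfect_def using cov block by blast
  qed
qed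

section \<open>Forced dominoes\<close>

text \<open>The normal position: for even \<open>n\<close> the coverings to be counted, for odd \<open>n\<close> their transposes.\<close>

locale cornered_perfect =
  fixes n :: nat and T :: "tile set"
  assumes two: "2 \<le> n"
    and perfect: "perfect n T"
    and origin: "Mono 0 0 \<in> T"
    and corner: "if even n then Mono 0 (n - 1) \<in> T else Mono (n - 1) 0 \<in> T"
begin

lemma cov: "covering n T"
  using perfect unfolding perfect_def by blast

lemma block:
  "Suc r < n \<Longrightarrow> Suc c < n \<Longrightarrow>
    HDom r c \<in> T \<or> HDom (Suc r) c \<in> T \<or> VDom r c \<in> T \<or> VDom r (Suc c) \<in> T"
  using perfect unfolding perfect_def by blast

lemma HDom_in_grid: "HDom r c \<in> T \<Longrightarrow> r < n \<and> Suc c < n"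
  and VDom_in_grid: "VDom r c \<in> T \<Longrightarrow> Suc r < n \<and> c < n"
  using covering_HDom[OF cov] covering_VDom[OF cov] by blast+

lemma clash:
  "HDom r c \<in> T \<Longrightarrow> HDom r (Suc c) \<notin> T"
  "VDom r c \<in> T \<Longrightarrow> VDom (Suc r) c \<notin> T"
  "HDom r c \<in> T \<Longrightarrow> VDom r c \<notin> T"
  "HDom r c \<in> T \<Longrightarrow> VDom r (Suc c) \<notin> T"
  "HDom (Suc r) c \<in> T \<Longrightarrow> VDom r c \<notin> T"
  "HDom (Suc r) c \<in> T \<Longrightarrow> VDom r (Suc c) \<notin> T"
  using covering_unique[OF cov, of "HDom r c" "HDom r (Suc c)" "(r, Suc c)"]
    covering_unique[OF cov, of "VDom r c" "VDom (Suc r) c" "(Suc r, c)"]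
    covering_unique[OF cov, of "HDom r c" "VDom r c" "(r, c)"]
    covering_unique[OF cov, of "HDom r c" "VDom r (Suc c)" "(r, Suc c)"]
    covering_unique[OF cov, of "HDom (Suc r) c" "VDom r c" "(Suc r, c)"]
    covering_unique[OF cov, of "HDom (Suc r) c" "VDom r (Suc c)" "(Suc r, Suc c)"]
  by auto

lemma clash_Mono:
  "Mono r c \<in> T \<Longrightarrow> HDom r c \<notin> T"
  "Mono r c \<in> T \<Longrightarrow> VDom r c \<notin> T"
  "Mono r (Suc c) \<in> T \<Longrightarrow> HDom r c \<notin> T"
  "Mono (Suc r) c \<in> T \<Longrightarrow> VDom r c \<notin> T"
  using covering_unique[OF cov, of "HDom r c" "Mono r c" "(r, c)"]
    covering_unique[OF cov, of "VDom r c" "Mono r c" "(r, c)"]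
    covering_unique[OF cov, of "HDom r c" "Mono r (Suc c)" "(r, Suc c)"]
    covering_unique[OF cov, of "VDom r c" "Mono (Suc r) c" "(Suc r, c)"]
  by auto

lemma not_flush:
  "HDom r c \<in> T \<Longrightarrow> HDom (Suc r) c \<notin> T"
  "VDom r c \<in> T \<Longrightarrow> VDom r (Suc c) \<notin> T"
  using perfect unfolding perfect_def by blast+

lemma interior_domino:
  assumes "Suc (Suc r) < n" "Suc (Suc c) < n"
  shows "HDom (Suc r) (Suc c) \<in> T \<or> VDom (Suc r) (Suc c) \<in> T \<or> HDom (Suc r) c \<in> T
    \<or> VDom r (Suc c) \<in> T"
proof -
  have "Mono (Suc r) (Suc c) \<notin> T"
    using perfect assms unfolding perfect_def by fastforce
  then show ?thesis using covering_cell[OF cov, of "Suc r" "Suc c"] assms by auto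
qed

text \<open>In the block at a corner of a domino, two of the four possible places for the domino of the block
overlap the given one.  The next eight lemmas name the two places that remain, by the direction in
which the block lies.\<close>

lemma HDom_NW: "HDom (Suc r) (Suc c) \<in> T \<Longrightarrow> HDom r c \<in> T \<or> VDom r c \<in> T"
  using block[of r c] clash(1)[of "Suc r" c] clash(5)[of r "Suc c"] HDom_in_grid[of "Suc r" "Suc c"]
  by auto

lemma HDom_SE:
  "HDom r c \<in> T \<Longrightarrow> Suc r < n \<Longrightarrow> Suc (Suc c) < n \<Longrightarrow>
    HDom (Suc r) (Suc c) \<in> T \<or> VDom r (Suc (Suc c)) \<in> T"
  using block[of r "Suc c"] clash(1)[of r c] clash(4)[of r c] by auto

lemma HDom_NE:
  "HDom (Suc r) c \<in> T \<Longrightarrow> Suc (Suc c) < n \<Longrightarrow> HDom r (Suc c) \<in> T \<or> VDom r (Suc (Suc c)) \<in> T"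
  using block[of r "Suc c"] clash(1)[of "Suc r" c] clash(6)[of r c] HDom_in_grid[of "Suc r" c]
  by auto

lemma HDom_SW:
  "HDom r (Suc c) \<in> T \<Longrightarrow> Suc r < n \<Longrightarrow> HDom (Suc r) c \<in> T \<or> VDom r c \<in> T"
  using block[of r c] clash(1)[of r c] clash(3)[of r "Suc c"] HDom_in_grid[of r "Suc c"] by auto

lemma VDom_NW: "VDom (Suc r) (Suc c) \<in> T \<Longrightarrow> HDom r c \<in> T \<or> VDom r c \<in> T"
  using block[of r c] clash(2)[of r "Suc c"] clash(4)[of "Suc r" c] VDom_in_grid[of "Suc r" "Suc c"]
  by auto

lemma VDom_NE:
  "VDom (Suc r) c \<in> T \<Longrightarrow> Suc c < n \<Longrightarrow> HDom r c \<in> T \<or> VDom r (Suc c) \<in> T"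
  using block[of r c] clash(2)[of r c] clash(3)[of "Suc r" c] VDom_in_grid[of "Suc r" c] by auto

lemma VDom_SW:
  "VDom r (Suc c) \<in> T \<Longrightarrow> Suc (Suc r) < n \<Longrightarrow>
    HDom (Suc (Suc r)) c \<in> T \<or> VDom (Suc r) c \<in> T"
  using block[of "Suc r" c] clash(2)[of r "Suc c"] clash(6)[of r c] VDom_in_grid[of r "Suc c"] by auto

lemma VDom_SE:
  "VDom r c \<in> T \<Longrightarrow> Suc (Suc r) < n \<Longrightarrow> Suc c < n \<Longrightarrow>
    HDom (Suc (Suc r)) c \<in> T \<or> VDom (Suc r) (Suc c) \<in> T"
  using block[of "Suc r" c] clash(2)[of r c] clash(5)[of r c] by auto

text \<open>By \<open>HDom_NW\<close> and \<open>VDom_NW\<close> the left or top cell of a domino is preceded on its diagonal by another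
left or top cell.  On the main diagonal this leads back to the monomino in the corner.\<close>

lemma no_first_cell_on_diagonal: "HDom k k \<notin> T \<and> VDom k k \<notin> T"
proof (induction k)
  case 0
  then show ?case using origin clash_Mono by blast
next
  case (Suc k)
  then show ?case using HDom_NW VDom_NW by blast
qed

text \<open>
A horizontal domino whose left cell has coordinate sum \<open>antidiagonal\<close> has one of its cells on the
antidiagonal of the square: the right one if \<open>n\<close> is even, the left one if \<open>n\<close> is odd.  The number is
even in both cases.\<close>

definition antidiagonal :: nat where
  "antidiagonal = (if even n then n - 2 else n - 1)"

text \<open>For even \<open>n\<close>, right and top cells propagate along antidiagonals to the upper right, for odd \<open>n\<close>, left
and bottom cells propagate to the lower left.  The second corner monomino stops them, but only
together with the vertical dominoes met on the way does the induction go through.\<close>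

lemma no_HDom_on_antidiagonal:
  assumes "r + c = antidiagonal"
  shows "HDom r c \<notin> T"
proof (cases "even n")
  case True
  have "(\<forall>c. r + c = n - 2 \<longrightarrow> HDom r c \<notin> T) \<and> (\<forall>c. r + c = n - 1 \<longrightarrow> VDom r c \<notin> T)" for r
  proof (induction r)
    case 0
    have "Mono 0 (Suc (n - 2)) \<in> T" "Mono 0 (n - 1) \<in> T"
      using corner True two by (simp_all add: Suc_diff_Suc numeral_2_eq_2)
    then show ?case using clash_Mono by auto
  next
    case (Suc r)
    have "HDom (Suc r) c \<notin> T" if "Suc r + c = n - 2" for c
    proof -
      have "Suc (Suc c) < n" "r + Suc c = n - 2" "r + Suc (Suc c) = n - 1"
        using that two by linarith+
      then show ?thesis using HDom_NE[of r c] Suc by blast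
    qed
    moreover have "VDom (Suc r) c \<notin> T" if "Suc r + c = n - 1" for c
    proof -
      have "Suc c < n" "r + c = n - 2" "r + Suc c = n - 1"
        using that two by linarith+
      then show ?thesis using VDom_NE[of r c] Suc by blast
    qed
    ultimately show ?case by blast
  qed
  then show ?thesis using assms True unfolding antidiagonal_def by auto
next
  case False
  have "(\<forall>r. r + c = n - 1 \<longrightarrow> HDom r c \<notin> T) \<and> (\<forall>r. r + c = n - 2 \<longrightarrow> VDom r c \<notin> T)" for c
  proof (induction c)
    case 0
    have "Mono (Suc (n - 2)) 0 \<in> T" "Mono (n - 1) 0 \<in> T"
      using corner False two by (simp_all add: Suc_diff_Suc numeral_2_eq_2)
    then show ?case using clash_Mono by auto
  next
    case (Suc c)
    have "HDom r (Suc c) \<notin> T" if "r + Suc c = n - 1" for r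
    proof -
      have "Suc r < n" "Suc r + c = n - 1" "r + c = n - 2"
        using that two by linarith+
      then show ?thesis using HDom_SW[of r c] Suc by blast
    qed
    moreover have "VDom r (Suc c) \<notin> T" if "r + Suc c = n - 2" for r
    proof -
      have "Suc (Suc r) < n" "Suc r + c = n - 2" "Suc (Suc r) + c = n - 1"
        using that two by linarith+
      then show ?thesis using VDom_SW[of r c] Suc by blast
    qed
    ultimately show ?case by blast
  qed
  then show ?thesis using assms False unfolding antidiagonal_def by auto
qed

lemma antidiagonal_even: "even antidiagonal"
  and antidiagonal_bounds: "antidiagonal \<le> n - 1" "n - 2 \<le> antidiagonal"
  unfolding antidiagonal_def by auto

text \<open>The two cells in the pocket below a horizontal domino that has vertical dominoes at both ends cannot
be covered by one domino, which would be flush with the horizontal one, nor by two vertical ones,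
which would be flush with each other.\<close>

lemma no_pocket_below:
  assumes "HDom r (Suc c) \<in> T" "VDom r c \<in> T" "VDom r (Suc (Suc (Suc c))) \<in> T" "Suc (Suc r) < n"
  shows False
proof -
  have c: "Suc (Suc (Suc c)) < n" using VDom_in_grid[OF assms(3)] by simp
  have "VDom (Suc r) (Suc c) \<in> T"
    using interior_domino[of r c] assms c clash(3)[of r "Suc c"] clash(5)[of r c] not_flush(1)[of r "Suc c"]
    by auto
  moreover have "VDom (Suc r) (Suc (Suc c)) \<in> T"
    using interior_domino[of r "Suc c"] assms c clash(4)[of r "Suc c"] clash(6)[of r "Suc (Suc c)"]
      not_flush(1)[of r "Suc c"] by auto
  ultimately show False using not_flush(2) by blast
qed

lemma no_pocket_above:
  assumes "HDom (Suc (Suc r)) (Suc c) \<in> T" "VDom (Suc r) c \<in> T" "VDom (Suc r) (Suc (Suc (Suc c))) \<in> T"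
  shows False
proof -
  have c: "Suc (Suc (Suc c)) < n" "Suc (Suc r) < n"
    using VDom_in_grid[OF assms(3)] by simp_all
  have "VDom r (Suc c) \<in> T"
    using interior_domino[of r c] assms c clash(5)[of "Suc r" "Suc c"] clash(3)[of "Suc r" c]
      not_flush(1)[of "Suc r" "Suc c"]
    by auto
  moreover have "VDom r (Suc (Suc c)) \<in> T"
    using interior_domino[of r "Suc c"] assms c clash(6)[of "Suc r" "Suc c"]
      clash(4)[of "Suc r" "Suc (Suc c)"] not_flush(1)[of "Suc r" "Suc c"] by auto
  ultimately show False using not_flush(2) by blast
qed

text \<open>The two forbidden lines \<open>r = c\<close> and \<open>r + c = antidiagonal\<close> divide the square into four triangles.
Diagonal steps change \<open>r - c\<close> and \<open>r + c\<close> by 0 or 2, so for left cells of even coordinate sum they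
cannot jump over a line.  Hence a horizontal domino of this kind that is closest to the centre in its
triangle has vertical dominoes in both diagonal directions towards the centre.  In the top and bottom
triangles they leave an impossible pocket, in the left and right ones they overlap.\<close>

lemma even_HDom_top:
  "HDom r c \<in> T \<Longrightarrow> even (r + c) \<Longrightarrow> r < c \<Longrightarrow> r + c < antidiagonal \<Longrightarrow> False"
proof (induction "n - r" arbitrary: r c rule: less_induct)
  case less
  obtain d where d: "c = Suc d" using less.prems(3) by (cases c) auto
  have rd: "Suc r \<le> d" using less.prems(2,3) unfolding d by presburger
  have K: "r + c + 2 \<le> antidiagonal" using less.prems(2,4) antidiagonal_even by presburger
  have r: "n - Suc r < n - r" using HDom_in_grid[OF less.prems(1)] by (simp add: diff_less_mono2)
  have b: "Suc (Suc r) < n" "Suc (Suc c) < n" using K antidiagonal_bounds rd d two by linarith+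
  have "HDom (Suc r) (Suc c) \<notin> T"
  proof
    assume h: "HDom (Suc r) (Suc c) \<in> T"
    then have "Suc r + Suc c \<noteq> antidiagonal" using no_HDom_on_antidiagonal by blast
    with less.hyps[OF r h] less.prems K show False by simp
  qed
  with HDom_SE[OF less.prems(1)] b have "VDom r (Suc (Suc c)) \<in> T" by simp
  moreover have "HDom (Suc r) d \<notin> T"
  proof
    assume h: "HDom (Suc r) d \<in> T"
    then have "Suc r \<noteq> d" using no_first_cell_on_diagonal by blast
    with less.hyps[OF r h] less.prems rd show False unfolding d by simp
  qed
  with HDom_SW[of r d] less.prems(1) b have "VDom r d \<in> T" unfolding d by simp
  ultimately show False using no_pocket_below less.prems(1) b unfolding d by blast
qed

lemma even_HDom_bottom:
  "HDom r c \<in> T \<Longrightarrow> even (r + c) \<Longrightarrow> c < r \<Longrightarrow> antidiagonal < r + c \<Longrightarrow> False"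
proof (induction r arbitrary: c rule: less_induct)
  case (less r)
  have K: "antidiagonal + 2 \<le> r + c" using less.prems(2,4) antidiagonal_even by presburger
  have rc: "c + 2 \<le> r" using less.prems(2,3) by presburger
  have "r < n" using HDom_in_grid[OF less.prems(1)] by simp
  with K rc antidiagonal_bounds have "1 \<le> c" by linarith
  then obtain d where d: "c = Suc d" by (cases c) auto
  obtain q where q: "r = Suc (Suc q)" using rc by (metis add_2_eq_Suc' le_Suc_ex add_Suc)
  have b: "Suc (Suc c) < n" using rc \<open>r < n\<close> by simp
  have "HDom (Suc q) d \<notin> T"
  proof
    assume h: "HDom (Suc q) d \<in> T"
    then have "Suc q + d \<noteq> antidiagonal" using no_HDom_on_antidiagonal by blast
    with less.IH[OF _ h] less.prems K rc show False unfolding d q by simp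
  qed
  with HDom_NW[of "Suc q" d] less.prems(1) have "VDom (Suc q) d \<in> T" unfolding d q by simp
  moreover have "HDom (Suc q) (Suc c) \<notin> T"
  proof
    assume h: "HDom (Suc q) (Suc c) \<in> T"
    then have "Suc q \<noteq> Suc c" using no_first_cell_on_diagonal by metis
    with less.IH[OF _ h] less.prems rc show False unfolding q by simp
  qed
  with HDom_NE[of "Suc q" c] less.prems(1) b have "VDom (Suc q) (Suc (Suc c)) \<in> T" unfolding q by simp
  ultimately show False using no_pocket_above less.prems(1) unfolding d q by blast
qed

lemma even_HDom_left:
  "HDom r c \<in> T \<Longrightarrow> even (r + c) \<Longrightarrow> c < r \<Longrightarrow> r + c < antidiagonal \<Longrightarrow> False"
proof (induction "n - c" arbitrary: r c rule: less_induct)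
  case less
  have K: "r + c + 2 \<le> antidiagonal" using less.prems(2,4) antidiagonal_even by presburger
  have rc: "c + 2 \<le> r" using less.prems(2,3) by presburger
  obtain q where q: "r = Suc q" using rc by (cases r) auto
  have c: "n - Suc c < n - c" using HDom_in_grid[OF less.prems(1)] by (simp add: diff_less_mono2)
  have b: "Suc r < n" "Suc (Suc c) < n" using K antidiagonal_bounds rc two by linarith+
  have "HDom (Suc r) (Suc c) \<notin> T"
  proof
    assume h: "HDom (Suc r) (Suc c) \<in> T"
    then have "Suc r + Suc c \<noteq> antidiagonal" using no_HDom_on_antidiagonal by blast
    with less.hyps[OF c h] less.prems K show False by simp
  qed
  with HDom_SE[OF less.prems(1)] b have "VDom r (Suc (Suc c)) \<in> T" by simp
  moreover have "HDom q (Suc c) \<notin> T"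
  proof
    assume h: "HDom q (Suc c) \<in> T"
    then have "q \<noteq> Suc c" using no_first_cell_on_diagonal by blast
    with less.hyps[OF c h] less.prems rc show False unfolding q by simp
  qed
  with HDom_NE[of q c] less.prems(1) b have "VDom q (Suc (Suc c)) \<in> T" unfolding q by simp
  ultimately show False using clash(2) unfolding q by blast
qed

lemma even_HDom_right:
  "HDom r c \<in> T \<Longrightarrow> even (r + c) \<Longrightarrow> r < c \<Longrightarrow> antidiagonal < r + c \<Longrightarrow> False"
proof (induction c arbitrary: r rule: less_induct)
  case (less c)
  have K: "antidiagonal + 2 \<le> r + c" using less.prems(2,4) antidiagonal_even by presburger
  have rc: "r + 2 \<le> c" using less.prems(2,3) by presburger
  have b: "r < n" "Suc c < n" using HDom_in_grid[OF less.prems(1)] by simp_all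
  with K rc antidiagonal_bounds have "1 \<le> r" by linarith
  then obtain q where q: "r = Suc q" by (cases r) auto
  obtain d where d: "c = Suc d" using rc by (cases c) auto
  have "HDom q d \<notin> T"
  proof
    assume h: "HDom q d \<in> T"
    then have "q + d \<noteq> antidiagonal" using no_HDom_on_antidiagonal by blast
    with less.IH[OF _ h] less.prems K rc show False unfolding d q by simp
  qed
  with HDom_NW[of q d] less.prems(1) have "VDom q d \<in> T" unfolding d q by simp
  moreover have "HDom (Suc r) d \<notin> T"
  proof
    assume h: "HDom (Suc r) d \<in> T"
    then have "Suc r \<noteq> d" using no_first_cell_on_diagonal by metis
    with less.IH[OF _ h] less.prems rc show False unfolding d by simp
  qed
  with HDom_SW[of r d] less.prems(1) b rc have "VDom r d \<in> T" unfolding d by simp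
  ultimately show False using clash(2) unfolding q by blast
qed

lemma HDom_odd:
  assumes "HDom r c \<in> T"
  shows "odd (r + c)"
proof
  assume e: "even (r + c)"
  have "r \<noteq> c" using assms no_first_cell_on_diagonal by blast
  moreover have "r + c \<noteq> antidiagonal" using assms no_HDom_on_antidiagonal by blast
  ultimately show False
    using assms e even_HDom_top even_HDom_bottom even_HDom_left even_HDom_right
    by (metis linorder_neqE_nat)
qed

end

section \<open>Brick tilings\<close>

text \<open>
In the following, \<open>V\<close> is the set of top cells of the vertical dominoes.\<close>

definition shade :: "(nat \<times> nat) set \<Rightarrow> (nat \<times> nat) set" where
  "shade V = {(r, c). (r, c) \<in> V \<or> (\<exists>q. r = Suc q \<and> (q, c) \<in> V)}"

definition bricks :: "nat \<Rightarrow> (nat \<times> nat) set \<Rightarrow> (nat \<times> nat) set" where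
  "bricks n V = {(r, c). r < n \<and> Suc c < n \<and> odd (r + c) \<and> (r, c) \<notin> shade V \<and> (r, Suc c) \<notin> shade V}"

definition brick_tiling :: "nat \<Rightarrow> (nat \<times> nat) set \<Rightarrow> tile set" where
  "brick_tiling n V = {VDom r c |r c. (r, c) \<in> V} \<union> {HDom r c |r c. (r, c) \<in> bricks n V} \<union>
     {Mono r c |r c. r < n \<and> c < n \<and> (r, c) \<notin> shade V \<and> (r, c) \<notin> bricks n V \<and>
        (\<forall>d. c = Suc d \<longrightarrow> (r, d) \<notin> bricks n V)}"

text \<open>Vertical dominoes whose top cell has odd coordinate sum continue to the upper right and lower left,
those with even sum to the lower right and upper left, until the boundary stops them.  The last two conditions
keep the two corner monominoes free; the second of these corners is \<open>(0, n - 1)\<close> for even \<open>n\<close> and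
\<open>(n - 1, 0)\<close>, the bottom cell of a domino at \<open>(n - 2, 0)\<close>, for odd \<open>n\<close>.\<close>

definition strip_closed :: "nat \<Rightarrow> (nat \<times> nat) set \<Rightarrow> bool" where
  "strip_closed n V \<longleftrightarrow>
     (\<forall>r c. (r, c) \<in> V \<longrightarrow> Suc r < n \<and> c < n \<and> (Suc r, c) \<notin> V \<and> (r, Suc c) \<notin> V) \<and>
     (\<forall>r c. (r, c) \<in> V \<longrightarrow> even (r + c) \<longrightarrow> Suc (Suc r) < n \<longrightarrow> Suc c < n \<longrightarrow> (Suc r, Suc c) \<in> V) \<and>
     (\<forall>r c. (Suc r, Suc c) \<in> V \<longrightarrow> even (r + c) \<longrightarrow> (r, c) \<in> V) \<and>
     (\<forall>r c. (Suc r, c) \<in> V \<longrightarrow> even (r + c) \<longrightarrow> Suc c < n \<longrightarrow> (r, Suc c) \<in> V) \<and>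
     (\<forall>r c. (r, Suc c) \<in> V \<longrightarrow> even (r + c) \<longrightarrow> Suc (Suc r) < n \<longrightarrow> (Suc r, c) \<in> V) \<and>
     (0, 0) \<notin> V \<and> (if even n then 0 else n - 2, if even n then n - 1 else 0) \<notin> V"

lemma in_brick_tiling [simp]:
  "VDom r c \<in> brick_tiling n V \<longleftrightarrow> (r, c) \<in> V"
  "HDom r c \<in> brick_tiling n V \<longleftrightarrow> (r, c) \<in> bricks n V"
  "Mono r c \<in> brick_tiling n V \<longleftrightarrow> r < n \<and> c < n \<and> (r, c) \<notin> shade V \<and> (r, c) \<notin> bricks n V \<and>
     (\<forall>d. c = Suc d \<longrightarrow> (r, d) \<notin> bricks n V)"
  unfolding brick_tiling_def by auto

context cornered_perfect
begin

text \<open>A vertical domino can be continued along its diagonal in two ways, and by \<open>HDom_odd\<close> one of them,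
a horizontal domino, has the wrong parity.\<close>

lemma strip_closed_VDom: "strip_closed n {(r, c). VDom r c \<in> T}"
proof -
  have corner': "VDom (if even n then 0 else n - 2) (if even n then n - 1 else 0) \<notin> T"
  proof (cases "even n")
    case False
    then have "Mono (Suc (n - 2)) 0 \<in> T"
      using corner two by (simp add: Suc_diff_Suc numeral_2_eq_2)
    with False show ?thesis using clash_Mono(4) by simp
  qed (use corner clash_Mono(2) in simp)
  have SE: "VDom (Suc r) (Suc c) \<in> T"
    if "VDom r c \<in> T" "even (r + c)" "Suc (Suc r) < n" "Suc c < n" for r c
    using VDom_SE[of r c] HDom_odd[of "Suc (Suc r)" c] that by auto
  have NW: "VDom r c \<in> T" if "VDom (Suc r) (Suc c) \<in> T" "even (r + c)" for r c
    using VDom_NW[of r c] HDom_odd[of r c] that by auto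
  have NE: "VDom r (Suc c) \<in> T" if "VDom (Suc r) c \<in> T" "even (r + c)" "Suc c < n" for r c
    using VDom_NE[of r c] HDom_odd[of r c] that by auto
  have SW: "VDom (Suc r) c \<in> T" if "VDom r (Suc c) \<in> T" "even (r + c)" "Suc (Suc r) < n" for r c
    using VDom_SW[of r c] HDom_odd[of "Suc (Suc r)" c] that by auto
  show ?thesis
    unfolding strip_closed_def mem_Collect_eq prod.case
    using VDom_in_grid clash(2) not_flush(2) SE NW NE SW corner' clash_Mono(2)[OF origin] by blast
qed

text \<open>If neither the odd cell \<open>(r, c)\<close> nor its right neighbour is in a vertical domino, then a block that
contains both of them has no other place for its domino.\<close>

lemma eq_brick_tiling: "T = brick_tiling n {(r, c). VDom r c \<in> T}"
proof -
  let ?V = "{(r, c). VDom r c \<in> T}"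
  have sh: "(r, c) \<in> shade ?V \<longleftrightarrow> VDom r c \<in> T \<or> (\<exists>q. r = Suc q \<and> VDom q c \<in> T)" for r c
    unfolding shade_def by simp
  have H: "HDom r c \<in> T \<longleftrightarrow> (r, c) \<in> bricks n ?V" for r c
  proof
    assume h: "HDom r c \<in> T"
    then show "(r, c) \<in> bricks n ?V"
      unfolding bricks_def mem_Collect_eq prod.case sh
      using HDom_in_grid[OF h] HDom_odd[OF h] clash(3-6) by blast
  next
    assume "(r, c) \<in> bricks n ?V"
    then have b: "r < n" "Suc c < n" "odd (r + c)"
      and nV: "VDom r c \<notin> T" "VDom r (Suc c) \<notin> T"
      "\<And>q. r = Suc q \<Longrightarrow> VDom q c \<notin> T" "\<And>q. r = Suc q \<Longrightarrow> VDom q (Suc c) \<notin> T"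
      unfolding bricks_def sh by auto
    show "HDom r c \<in> T"
    proof (cases "Suc r < n")
      case True
      with block[of r c] b nV HDom_odd[of "Suc r" c] show ?thesis by auto
    next
      case False
      then obtain q where q: "r = Suc q" using two b by (cases r) auto
      with block[of q c] b nV HDom_odd[of q c] show ?thesis by auto
    qed
  qed
  have M: "Mono r c \<in> T \<longleftrightarrow> Mono r c \<in> brick_tiling n ?V" for r c
    unfolding in_brick_tiling H[symmetric] sh
    using covering_Mono[OF cov, of r c] clash_Mono covering_cell[OF cov, of r c] by blast
  show ?thesis
  proof (rule set_eqI)
    show "t \<in> T \<longleftrightarrow> t \<in> brick_tiling n ?V" for t
      by (cases t) (simp_all only: M H in_brick_tiling mem_Collect_eq prod.case)
  qed
qed

end

lemma covering_brick_tiling: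
  assumes "strip_closed n V"
  shows "covering n (brick_tiling n V)"
proof -
  let ?T = "brick_tiling n V"
  have V: "Suc r < n \<and> c < n \<and> (Suc r, c) \<notin> V \<and> (r, Suc c) \<notin> V" if "(r, c) \<in> V" for r c
    using assms that unfolding strip_closed_def by blast
  have union: "(\<Union>t\<in>?T. cells t) = {0..<n} \<times> {0..<n}"
  proof
    show "(\<Union>t\<in>?T. cells t) \<subseteq> {0..<n} \<times> {0..<n}"
    proof (rule UN_least)
      fix t assume "t \<in> ?T"
      then show "cells t \<subseteq> {0..<n} \<times> {0..<n}"
        by (cases t) (auto simp: bricks_def dest: V)
    qed
    show "{0..<n} \<times> {0..<n} \<subseteq> (\<Union>t\<in>?T. cells t)"
    proof
      fix x assume "x \<in> {0..<n} \<times> {0..<n}"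
      then obtain r c where x: "x = (r, c)" and rc: "r < n" "c < n" by auto
      have "\<exists>t\<in>?T. (r, c) \<in> cells t"
      proof (cases "Mono r c \<in> ?T")
        case True
        then show ?thesis by (rule bexI[rotated]) simp
      next
        case False
        then consider "(r, c) \<in> V" | q where "r = Suc q" "(q, c) \<in> V" | "(r, c) \<in> bricks n V"
          | d where "c = Suc d" "(r, d) \<in> bricks n V"
          using rc unfolding in_brick_tiling shade_def by auto
        then show ?thesis
        proof cases
          case 1
          then show ?thesis by (intro bexI[of _ "VDom r c"]) simp_all
        next
          case 2
          then show ?thesis by (intro bexI[of _ "VDom q c"]) simp_all
        next
          case 3
          then show ?thesis by (intro bexI[of _ "HDom r c"]) simp_all
        next
          case 4
          then show ?thesis by (intro bexI[of _ "HDom r d"]) simp_all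
        qed
      qed
      then show "x \<in> (\<Union>t\<in>?T. cells t)" unfolding x by blast
    qed
  qed
  have disj: "t = u" if "t \<in> ?T" "u \<in> ?T" "(r, c) \<in> cells t" "(r, c) \<in> cells u" for t u r c
  proof -
    have VV: "(Suc q, c) \<notin> V" if "(q, c) \<in> V" for q using V that by blast
    have HV: "(r, c) \<notin> V" "(r, Suc c) \<notin> V" "r = Suc q \<Longrightarrow> (q, c) \<notin> V" "r = Suc q \<Longrightarrow> (q, Suc c) \<notin> V"
      if "(r, c) \<in> bricks n V" for r c q
      using that unfolding bricks_def shade_def by auto
    have HH: "(r, Suc c) \<notin> bricks n V" if "(r, c) \<in> bricks n V" for r c
      using that unfolding bricks_def by simp
    from that show ?thesis
      unfolding in_cells_iff
      by (elim disjE exE conjE)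
        (auto simp: shade_def dest: VV HV HH)
  qed
  show ?thesis
    unfolding covering_def union
  proof (intro conjI ballI impI equals0I refl)
    fix t u x assume "t \<in> ?T" "u \<in> ?T" "t \<noteq> u" "x \<in> cells t \<inter> cells u"
    then show False using disj[of t u "fst x" "snd x"] by simp
  qed
qed

text \<open>A brick is missing from a block only because a vertical domino covers one of its cells, and then
the continuation of the strip of that domino passes through the block.  The same argument
covers the cells off the boundary.\<close>

lemma cornered_perfect_brick_tiling:
  assumes "2 \<le> n" and V: "strip_closed n V"
  shows "cornered_perfect n (brick_tiling n V)"
proof
  let ?T = "brick_tiling n V"
  have V: "(r, c) \<in> V \<Longrightarrow> Suc r < n \<and> c < n \<and> (Suc r, c) \<notin> V \<and> (r, Suc c) \<notin> V"
    and SE: "(r, c) \<in> V \<Longrightarrow> even (r + c) \<Longrightarrow> Suc (Suc r) < n \<Longrightarrow> Suc c < n \<Longrightarrow> (Suc r, Suc c) \<in> V"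
    and NW: "(Suc r, Suc c) \<in> V \<Longrightarrow> even (r + c) \<Longrightarrow> (r, c) \<in> V"
    and NE: "(Suc r, c) \<in> V \<Longrightarrow> even (r + c) \<Longrightarrow> Suc c < n \<Longrightarrow> (r, Suc c) \<in> V"
    and SW: "(r, Suc c) \<in> V \<Longrightarrow> even (r + c) \<Longrightarrow> Suc (Suc r) < n \<Longrightarrow> (Suc r, c) \<in> V"
    and corners: "(0, 0) \<notin> V" "(if even n then 0 else n - 2, if even n then n - 1 else 0) \<notin> V" for r c
    using V unfolding strip_closed_def by blast+
  show "2 \<le> n" by fact
  have block: "(r, c) \<in> bricks n V \<or> (Suc r, c) \<in> bricks n V \<or> (r, c) \<in> V \<or> (r, Suc c) \<in> V"
    if "Suc r < n" "Suc c < n" for r c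
  proof (rule ccontr)
    assume no: "\<not> ?thesis"
    show False
    proof (cases "even (r + c)")
      case False
      with no that have "(r, c) \<in> shade V \<or> (r, Suc c) \<in> shade V" unfolding bricks_def by auto
      with no obtain q where "r = Suc q" "(q, c) \<in> V \<or> (q, Suc c) \<in> V"
        unfolding shade_def by auto
      with no that False SE[of q c] SW[of q c] show False by auto
    next
      case True
      with no that have "(Suc r, c) \<in> shade V \<or> (Suc r, Suc c) \<in> shade V" unfolding bricks_def by auto
      with no have "(Suc r, c) \<in> V \<or> (Suc r, Suc c) \<in> V" unfolding shade_def by auto
      with no that True NE[of r c] NW[of r c] show False by auto
    qed
  qed
  have inner: "r = 0 \<or> c = 0 \<or> Suc r = n \<or> Suc c = n" if m: "Mono r c \<in> ?T" for r c
  proof (rule ccontr)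
    assume no: "\<not> ?thesis"
    then obtain q d where q: "r = Suc q" and d: "c = Suc d" by (metis not0_implies_Suc)
    have b: "Suc r < n" "Suc c < n" using no m by auto
    have m': "(r, c) \<notin> shade V" "(r, c) \<notin> bricks n V" "(r, d) \<notin> bricks n V"
      using m d by auto
    then have nV: "(r, c) \<notin> V" "(q, c) \<notin> V" unfolding shade_def q by auto
    show False
    proof (cases "even (r + c)")
      case False
      then have "(r, Suc c) \<in> shade V" using m' b unfolding bricks_def by auto
      then have "(r, Suc c) \<in> V \<or> (q, Suc c) \<in> V" unfolding shade_def q by auto
      with nV b False NW[of q c] SW[of q c] show False unfolding q by auto
    next
      case True
      then have "(r, d) \<in> shade V" using m' b unfolding bricks_def d by auto
      then have "(r, d) \<in> V \<or> (q, d) \<in> V" unfolding shade_def q by auto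
      with nV b True NE[of q d] SE[of q d] show False unfolding q d by auto
    qed
  qed
  have "\<not> ((r, c) \<in> bricks n V \<and> (Suc r, c) \<in> bricks n V)" for r c unfolding bricks_def by auto
  then show "perfect n ?T"
    unfolding perfect_def in_brick_tiling(1,2)
    using covering_brick_tiling[OF assms(2)] block inner V by blast
  show "Mono 0 0 \<in> ?T"
    using corners(1) assms(1) by (auto simp: shade_def bricks_def)
  show "if even n then Mono 0 (n - 1) \<in> ?T else Mono (n - 1) 0 \<in> ?T"
  proof (cases "even n")
    case True
    have "even d" if "n - Suc 0 = Suc d" for d
    proof -
      have "n = Suc (Suc d)" using that by simp
      with True show ?thesis by simp
    qed
    with True corners(2) assms(1) show ?thesis by (auto simp: shade_def bricks_def)
  next
    case False
    have "(n - 1, 0) \<notin> V" using V[of "n - 1" 0] assms(1) by auto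
    moreover have "(q, 0) \<notin> V" if "n - 1 = Suc q" for q
    proof -
      have "q = n - 2" using that by simp
      with False corners(2) show ?thesis by simp
    qed
    moreover have "even (n - 1)" using False by simp
    ultimately show ?thesis using False assms(1) by (simp add: shade_def bricks_def)
  qed
qed

section \<open>Strips of vertical dominoes\<close>

text \<open>The strip with \<open>k\<close> vertical dominoes along an antidiagonal, given by their top cells.  Odd coordinate
sums up to \<open>n - 2\<close> give the even lengths and the larger ones the odd lengths, so that each length
below \<open>n\<close> occurs once.  Strips along diagonals are treated alike.\<close>

definition anti_strip :: "nat \<Rightarrow> nat \<Rightarrow> (nat \<times> nat) set" where
  "anti_strip n k = {(r, c). Suc r < n \<and> c < n \<and> r + c = (if even k then k - 1 else 2 * n - 2 - k)}"

definition main_strip :: "nat \<Rightarrow> nat \<Rightarrow> (nat \<times> nat) set" where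
  "main_strip n k =
     {(r, c). Suc r < n \<and> c < n \<and> (if even (n - k) then c = r + (n - k) else r = c + (n - 1 - k))}"

lemma anti_strip_odd: "1 \<le> k \<Longrightarrow> k < n \<Longrightarrow> (r, c) \<in> anti_strip n k \<Longrightarrow> odd (r + c)"
  unfolding anti_strip_def by (auto split: if_splits)

lemma main_strip_even: "1 \<le> k \<Longrightarrow> k < n \<Longrightarrow> (r, c) \<in> main_strip n k \<Longrightarrow> even (r + c)"
  unfolding main_strip_def by (auto split: if_splits)

lemma anti_strip_param:
  assumes "1 \<le> k" "k < n"
  shows "anti_strip n k =
    (\<lambda>i. if even k then (k - 1 - i, i) else (n - 1 - k + i, n - 1 - i)) ` {0..<k}"
proof (cases "even k")
  case True
  have "(r, c) \<in> (\<lambda>i. (k - 1 - i, i)) ` {0..<k}" if "(r, c) \<in> anti_strip n k" for r c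
    using that True assms unfolding anti_strip_def by (intro image_eqI[of _ _ c]) auto
  moreover have "(k - 1 - i, i) \<in> anti_strip n k" if "i < k" for i
    using that True assms unfolding anti_strip_def by auto
  ultimately show ?thesis using True by auto
next
  case False
  have "(r, c) \<in> (\<lambda>i. (n - 1 - k + i, n - 1 - i)) ` {0..<k}" if "(r, c) \<in> anti_strip n k" for r c
    using that False assms unfolding anti_strip_def by (intro image_eqI[of _ _ "n - 1 - c"]) auto
  moreover have "(n - 1 - k + i, n - 1 - i) \<in> anti_strip n k" if "i < k" for i
    using that False assms unfolding anti_strip_def by auto
  ultimately show ?thesis using False by auto
qed

lemma main_strip_param:
  assumes "1 \<le> k" "k < n"
  shows "main_strip n k =
    (\<lambda>i. if even (n - k) then (i, i + (n - k)) else (i + (n - 1 - k), i)) ` {0..<k}"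
proof (cases "even (n - k)")
  case True
  have "(r, c) \<in> (\<lambda>i. (i, i + (n - k))) ` {0..<k}" if "(r, c) \<in> main_strip n k" for r c
    using that True assms unfolding main_strip_def by (intro image_eqI[of _ _ r]) auto
  moreover have "(i, i + (n - k)) \<in> main_strip n k" if "i < k" for i
  proof -
    have "2 \<le> n - k" using True assms by presburger
    then show ?thesis using that True assms unfolding main_strip_def by auto
  qed
  ultimately show ?thesis using True by auto
next
  case False
  have "(r, c) \<in> (\<lambda>i. (i + (n - 1 - k), i)) ` {0..<k}" if "(r, c) \<in> main_strip n k" for r c
    using that False assms unfolding main_strip_def by (intro image_eqI[of _ _ c]) auto
  moreover have "(i + (n - 1 - k), i) \<in> main_strip n k" if "i < k" for i
    using that False assms unfolding main_strip_def by auto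
  ultimately show ?thesis using False by auto
qed

lemma card_anti_strip: "1 \<le> k \<Longrightarrow> k < n \<Longrightarrow> card (anti_strip n k) = k"
  unfolding anti_strip_param by (subst card_image) (auto simp: inj_on_def)

lemma card_main_strip: "1 \<le> k \<Longrightarrow> k < n \<Longrightarrow> card (main_strip n k) = k"
  unfolding main_strip_param by (subst card_image) (auto simp: inj_on_def)

lemma anti_strip_unique:
  "\<lbrakk>x \<in> anti_strip n k; x \<in> anti_strip n l; 1 \<le> k; k < n; 1 \<le> l; l < n\<rbrakk> \<Longrightarrow> k = l"
  unfolding anti_strip_def by (auto split: if_splits)

lemma main_strip_unique:
  "\<lbrakk>x \<in> main_strip n k; x \<in> main_strip n l; 1 \<le> k; k < n; 1 \<le> l; l < n\<rbrakk> \<Longrightarrow> k = l"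
  unfolding main_strip_def by (auto split: if_splits)

lemma anti_strip_step:
  "(Suc r, c) \<in> anti_strip n k \<Longrightarrow> Suc c < n \<Longrightarrow> (r, Suc c) \<in> anti_strip n k"
  "(r, Suc c) \<in> anti_strip n k \<Longrightarrow> Suc (Suc r) < n \<Longrightarrow> (Suc r, c) \<in> anti_strip n k"
  unfolding anti_strip_def by simp_all

lemma main_strip_step:
  "(r, c) \<in> main_strip n k \<Longrightarrow> Suc (Suc r) < n \<Longrightarrow> Suc c < n \<Longrightarrow> (Suc r, Suc c) \<in> main_strip n k"
  "(Suc r, Suc c) \<in> main_strip n k \<Longrightarrow> (r, c) \<in> main_strip n k"
  unfolding main_strip_def by (cases "even (n - k)"; simp)+

text \<open>Every vertical domino belongs to a strip.  The length \<open>n - 1\<close> occurs here; it belongs to the strip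
that ends in a corner monomino and is not used by \<open>strip_union\<close>.\<close>

lemma ex_anti_strip:
  assumes "Suc r < n" "c < n" "odd (r + c)"
  shows "\<exists>k. 1 \<le> k \<and> k < n \<and> (r, c) \<in> anti_strip n k"
proof (cases "r + c \<le> n - 2")
  case True
  then show ?thesis
    using assms unfolding anti_strip_def by (intro exI[of _ "Suc (r + c)"]) auto
next
  case False
  define k where "k = 2 * n - 2 - (r + c)"
  have k: "1 \<le> k" "k < n" "r + c = 2 * n - 2 - k" "2 * n - 2 = k + (r + c)"
    unfolding k_def using False assms by linarith+
  have "odd k"
  proof -
    have "even (2 * n - 2)" by simp
    then show ?thesis using assms(3) unfolding k(4) by simp
  qed
  then show ?thesis using k(1-3) assms unfolding anti_strip_def by (intro exI[of _ k]) auto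
qed

lemma ex_main_strip:
  assumes "Suc r < n" "c < n" "even (r + c)"
  shows "\<exists>k. 1 \<le> k \<and> k < n \<and> (r, c) \<in> main_strip n k"
proof (cases "r < c")
  case True
  define k where "k = n - (c - r)"
  have k: "1 \<le> k" "k < n" "n - k = c - r" unfolding k_def using True assms by auto
  have "even (c - r)" using assms(3) True by simp
  then show ?thesis using k True assms unfolding main_strip_def by (intro exI[of _ k]) auto
next
  case False
  define k where "k = n - 1 - (r - c)"
  have k: "1 \<le> k" "k < n" "n - k = Suc (r - c)" "n - 1 - k = r - c"
    unfolding k_def using False assms by auto
  have "even (r - c)" using assms(3) False by (simp add: add.commute)
  then show ?thesis using k False assms unfolding main_strip_def by (intro exI[of _ k]) auto
qed

definition strip_union :: "nat \<Rightarrow> nat set \<times> nat set \<Rightarrow> (nat \<times> nat) set" where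
  "strip_union n = (\<lambda>(A, B). (\<Union>k\<in>A. anti_strip n k) \<union> (\<Union>k\<in>B. main_strip n k))"

text \<open>The sizes of the strips in the two directions; the last condition says that no two strips conflict.\<close>

definition admissible :: "nat \<Rightarrow> (nat set \<times> nat set) set" where
  "admissible n = {(A, B). A \<subseteq> {1..n - 2} \<and> B \<subseteq> {1..n - 2} \<and> (\<forall>a\<in>A. \<forall>b\<in>B. a + b \<le> n - 2)}"

lemma card_strip_union:
  assumes "2 \<le> n" "A \<subseteq> {1..n - 2}" "B \<subseteq> {1..n - 2}"
  shows "card (strip_union n (A, B)) = \<Sum>A + \<Sum>B"
proof -
  have k: "1 \<le> k \<and> k < n" if "k \<in> A \<or> k \<in> B" for k using assms that by fastforce
  have fin: "finite A" "finite B" using assms by (auto intro: finite_subset)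
  have finS: "finite (anti_strip n k)" "finite (main_strip n k)" for k
    unfolding anti_strip_def main_strip_def
    by (rule finite_subset[of _ "{0..<n} \<times> {0..<n}"]; auto)+
  have "card (strip_union n (A, B)) = card (\<Union>k\<in>A. anti_strip n k) + card (\<Union>k\<in>B. main_strip n k)"
    unfolding strip_union_def prod.case
  proof (rule card_Un_disjoint)
    show "(\<Union>k\<in>A. anti_strip n k) \<inter> (\<Union>k\<in>B. main_strip n k) = {}"
    proof (rule equals0I)
      fix x assume x: "x \<in> (\<Union>k\<in>A. anti_strip n k) \<inter> (\<Union>k\<in>B. main_strip n k)"
      obtain r c where rc: "x = (r, c)" by (cases x)
      from x obtain a b where "a \<in> A" "(r, c) \<in> anti_strip n a" "b \<in> B" "(r, c) \<in> main_strip n b"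
        unfolding rc by blast
      then show False using anti_strip_odd[of a n r c] main_strip_even[of b n r c] k by blast
    qed
  qed (use fin finS in auto)
  moreover have "card (\<Union>k\<in>A. anti_strip n k) = \<Sum>A"
  proof -
    have "card (\<Union>k\<in>A. anti_strip n k) = (\<Sum>k\<in>A. card (anti_strip n k))"
      using fin finS anti_strip_unique k by (intro card_UN_disjoint) blast+
    also have "\<dots> = \<Sum>A" using card_anti_strip k by (intro sum.cong) auto
    finally show ?thesis .
  qed
  moreover have "card (\<Union>k\<in>B. main_strip n k) = \<Sum>B"
  proof -
    have "card (\<Union>k\<in>B. main_strip n k) = (\<Sum>k\<in>B. card (main_strip n k))"
      using fin finS main_strip_unique k by (intro card_UN_disjoint) blast+
    also have "\<dots> = \<Sum>B" using card_main_strip k by (intro sum.cong) auto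
    finally show ?thesis .
  qed
  ultimately show ?thesis by simp
qed

text \<open>If the strips are long enough to cross, then at the crossing there are two dominoes that are flush
(same row) or overlap (same column).  Writing \<open>a\<close> and \<open>n - b\<close> as multiples of two, up to parity,
gives the coordinates of the crossing; the four parities tell at which side of the square it comes
first into existence.\<close>

lemma strips_conflict:
  assumes "1 \<le> a" "a \<le> n - 2" "1 \<le> b" "b \<le> n - 2" "n - 1 \<le> a + b"
  shows "\<exists>r c r' c'. (r, c) \<in> anti_strip n a \<and> (r', c') \<in> main_strip n b \<and>
    (r = r' \<and> (c' = Suc c \<or> c = Suc c') \<or> c = c' \<and> (r' = Suc r \<or> r = Suc r'))"
proof (cases "even a")
  case True
  show ?thesis
  proof (cases "even (n - b)")
    case nb: True
    obtain x where x: "a = 2 * x" using True by (rule evenE)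
    obtain y where y: "n - b = 2 * y" using nb by (rule evenE)
    have "y \<le> x" using assms x y by linarith
    then have "(x - y, x + y - 1) \<in> anti_strip n a" "(x - y, x + y) \<in> main_strip n b"
      using assms x y True nb unfolding anti_strip_def main_strip_def by auto
    moreover have "x + y = Suc (x + y - 1)" using assms x by simp
    ultimately show ?thesis by blast
  next
    case nb: False
    obtain x where x: "a = 2 * x" using True by (rule evenE)
    obtain y where y: "n - b = 2 * y + 1" using nb by (rule oddE)
    have "y \<le> x" using assms x y by linarith
    then have "(x + y - 1, x - y) \<in> anti_strip n a" "(x + y, x - y) \<in> main_strip n b"
      using assms x y True nb unfolding anti_strip_def main_strip_def by auto
    moreover have "x + y = Suc (x + y - 1)" using assms x by simp
    ultimately show ?thesis by blast
  qed
next
  case False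
  show ?thesis
  proof (cases "even (n - b)")
    case nb: True
    obtain x where x: "a = 2 * x + 1" using False by (rule oddE)
    obtain y where y: "n - b = 2 * y" using nb by (rule evenE)
    have "y \<le> Suc x" "1 \<le> y" using assms x y by linarith+
    define c where "c = n + y - x - 2"
    have c: "c \<le> n - 1" "2 * y \<le> c" "c + y + x + 2 = n + 2 * y"
      unfolding c_def using assms x y by linarith+
    have "(Suc c - 2 * y, c) \<in> anti_strip n a" "(c - 2 * y, c) \<in> main_strip n b"
      using c \<open>1 \<le> y\<close> assms x y False nb unfolding anti_strip_def main_strip_def by auto
    moreover have "Suc c - 2 * y = Suc (c - 2 * y)" using c by simp
    ultimately show ?thesis by blast
  next
    case nb: False
    obtain x where x: "a = 2 * x + 1" using False by (rule oddE)
    obtain y where y: "n - b = 2 * y + 1" using nb by (rule oddE)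
    have "y \<le> x" using assms x y by linarith
    define r where "r = n + y - x - 2"
    have r: "r \<le> n - 2" "2 * y \<le> r" "r + x + 2 = n + y"
      unfolding r_def using assms x y \<open>y \<le> x\<close> by linarith+
    have "(r, Suc r - 2 * y) \<in> anti_strip n a" "(r, r - 2 * y) \<in> main_strip n b"
      using r assms x y False nb unfolding anti_strip_def main_strip_def by auto
    moreover have "Suc r - 2 * y = Suc (r - 2 * y)" using r by simp
    ultimately show ?thesis by blast
  qed
qed

lemma strips_compatible:
  assumes "1 \<le> a" "1 \<le> b" "a + b \<le> n - 2" "(r, c) \<in> anti_strip n a" "(r', c') \<in> main_strip n b"
  shows "\<not> (r = r' \<and> (c' = Suc c \<or> c = Suc c') \<or> c = c' \<and> (r' = Suc r \<or> r = Suc r'))"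
  using assms unfolding anti_strip_def main_strip_def by (auto split: if_splits)

text \<open>Only dominoes of different directions have to be kept apart, because top cells of one direction have
equal parity.\<close>

lemma strip_closed_strip_union:
  assumes "2 \<le> n" "(A, B) \<in> admissible n"
  shows "strip_closed n (strip_union n (A, B))"
proof -
  let ?V = "strip_union n (A, B)"
  have k: "1 \<le> k \<and> k \<le> n - 2 \<and> k < n" if "k \<in> A \<or> k \<in> B" for k
    using assms that unfolding admissible_def by fastforce
  have ab: "a + b \<le> n - 2" if "a \<in> A" "b \<in> B" for a b
    using assms that unfolding admissible_def by blast
  have odd: "(r, c) \<in> ?V \<longleftrightarrow> (\<exists>a\<in>A. (r, c) \<in> anti_strip n a)" if "odd (r + c)" for r c
    using main_strip_even[of _ n r c] k that unfolding strip_union_def by blast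
  have even: "(r, c) \<in> ?V \<longleftrightarrow> (\<exists>b\<in>B. (r, c) \<in> main_strip n b)" if "even (r + c)" for r c
    using anti_strip_odd[of _ n r c] k that unfolding strip_union_def by blast
  have grid: "Suc r < n \<and> c < n" if "(r, c) \<in> ?V" for r c
    using that unfolding strip_union_def anti_strip_def main_strip_def by auto
  have apart: "\<not> (r = r' \<and> (c' = Suc c \<or> c = Suc c') \<or> c = c' \<and> (r' = Suc r \<or> r = Suc r'))"
    if "(r, c) \<in> ?V" "(r', c') \<in> ?V" "odd (r + c)" "even (r' + c')" for r c r' c'
    using that odd even strips_compatible ab k by metis
  have free: "(Suc r, c) \<notin> ?V \<and> (r, Suc c) \<notin> ?V" if "(r, c) \<in> ?V" for r c
    using that apart[of r c "Suc r" c] apart[of r c r "Suc c"] apart[of "Suc r" c r c]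
      apart[of r "Suc c" r c]
    by (cases "even (r + c)") auto
  have SE: "(Suc r, Suc c) \<in> ?V" if a: "(r, c) \<in> ?V" "even (r + c)" "Suc (Suc r) < n" "Suc c < n" for r c
  proof -
    obtain k where k: "k \<in> B" "(r, c) \<in> main_strip n k"
      using even[of r c] a by auto
    then have "(Suc r, Suc c) \<in> main_strip n k" using main_strip_step(1) a by blast
    with k(1) show ?thesis unfolding strip_union_def by blast
  qed
  have NW: "(r, c) \<in> ?V" if a: "(Suc r, Suc c) \<in> ?V" "even (r + c)" for r c
  proof -
    obtain k where k: "k \<in> B" "(Suc r, Suc c) \<in> main_strip n k"
      using even[of "Suc r" "Suc c"] a by auto
    then have "(r, c) \<in> main_strip n k" using main_strip_step(2) a by blast
    with k(1) show ?thesis unfolding strip_union_def by blast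
  qed
  have NE: "(r, Suc c) \<in> ?V" if a: "(Suc r, c) \<in> ?V" "even (r + c)" "Suc c < n" for r c
  proof -
    obtain k where k: "k \<in> A" "(Suc r, c) \<in> anti_strip n k"
      using odd[of "Suc r" c] a by auto
    then have "(r, Suc c) \<in> anti_strip n k" using anti_strip_step(1) a by blast
    with k(1) show ?thesis unfolding strip_union_def by blast
  qed
  have SW: "(Suc r, c) \<in> ?V" if a: "(r, Suc c) \<in> ?V" "even (r + c)" "Suc (Suc r) < n" for r c
  proof -
    obtain k where k: "k \<in> A" "(r, Suc c) \<in> anti_strip n k"
      using odd[of r "Suc c"] a by auto
    then have "(Suc r, c) \<in> anti_strip n k" using anti_strip_step(2) a by blast
    with k(1) show ?thesis unfolding strip_union_def by blast
  qed
  have c0: "(0, 0) \<notin> ?V"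
    using even[of 0 0] k by (force simp: main_strip_def split: if_splits)
  have c1: "(if even n then 0 else n - 2, if even n then n - 1 else 0) \<notin> ?V"
  proof (cases "even n")
    case True
    then have "odd (0 + (n - 1))" using assms(1) by simp
    from odd[OF this] True k show ?thesis by (force simp: anti_strip_def split: if_splits)
  next
    case False
    then have "odd (n - 2 + 0)" using assms(1) by simp
    from odd[OF this] False k assms(1) show ?thesis by (force simp: anti_strip_def split: if_splits)
  qed
  show ?thesis
    unfolding strip_closed_def using grid free SE NW NE SW c0 c1 by blast
qed

lemma whole_anti_strip:
  assumes V: "strip_closed n V" and x: "x \<in> V" "x \<in> anti_strip n k" and k: "1 \<le> k" "k < n"
  shows "anti_strip n k \<subseteq> V"
proof -
  have step: "(Suc r, c) \<in> V \<Longrightarrow> even (r + c) \<Longrightarrow> Suc c < n \<Longrightarrow> (r, Suc c) \<in> V"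
    "(r, Suc c) \<in> V \<Longrightarrow> even (r + c) \<Longrightarrow> Suc (Suc r) < n \<Longrightarrow> (Suc r, c) \<in> V" for r c
    using V unfolding strip_closed_def by blast+
  have NE: "(r + j, c) \<in> V \<Longrightarrow> odd (r + j + c) \<Longrightarrow> c + j < n \<Longrightarrow> (r, c + j) \<in> V" for r c j
  proof (induction j arbitrary: c)
    case (Suc j)
    have "(r + j, Suc c) \<in> V"
      using step(1)[of "r + j" c] Suc.prems by auto
    with Suc.IH[of "Suc c"] Suc.prems show ?case by simp
  qed simp
  have SW: "(r, c + j) \<in> V \<Longrightarrow> odd (r + j + c) \<Longrightarrow> Suc (r + j) < n \<Longrightarrow> (r + j, c) \<in> V" for r c j
  proof (induction j arbitrary: r)
    case (Suc j)
    have "(Suc r, c + j) \<in> V"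
      using step(2)[of r "c + j"] Suc.prems by auto
    with Suc.IH[of "Suc r"] Suc.prems show ?case by simp
  qed simp
  obtain r c where rc: "x = (r, c)" by (cases x)
  have o: "odd (r + c)" using anti_strip_odd[OF k] x rc by blast
  show ?thesis
  proof
    fix y assume y: "y \<in> anti_strip n k"
    obtain r' c' where rc': "y = (r', c')" by (cases y)
    have e: "r + c = r' + c'" "Suc r' < n" "c' < n"
      using x y unfolding rc rc' anti_strip_def by auto
    show "y \<in> V"
    proof (cases "r' \<le> r")
      case True
      then obtain j where "r = r' + j" using le_Suc_ex by blast
      moreover from this have "c' = c + j" using e by simp
      ultimately show ?thesis using NE[of r' j c] x e o unfolding rc rc' by simp
    next
      case False
      then obtain j where "r' = r + j" using le_Suc_ex nat_le_linear by blast
      moreover from this have "c = c' + j" using e by simp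
      moreover from this have "odd (r + j + c')" using o by auto
      ultimately show ?thesis using SW[of r c' j] x e unfolding rc rc' by simp
    qed
  qed
qed

lemma whole_main_strip:
  assumes V: "strip_closed n V" and x: "x \<in> V" "x \<in> main_strip n k" and k: "1 \<le> k" "k < n"
  shows "main_strip n k \<subseteq> V"
proof -
  have step: "(r, c) \<in> V \<Longrightarrow> even (r + c) \<Longrightarrow> Suc (Suc r) < n \<Longrightarrow> Suc c < n \<Longrightarrow> (Suc r, Suc c) \<in> V"
    "(Suc r, Suc c) \<in> V \<Longrightarrow> even (r + c) \<Longrightarrow> (r, c) \<in> V" for r c
    using V unfolding strip_closed_def by blast+
  have SE: "(r, c) \<in> V \<Longrightarrow> even (r + c) \<Longrightarrow> Suc (r + j) < n \<Longrightarrow> c + j < n \<Longrightarrow> (r + j, c + j) \<in> V"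
    for r c j
  proof (induction j)
    case (Suc j)
    then have "(r + j, c + j) \<in> V" by simp
    with step(1)[of "r + j" "c + j"] Suc.prems show ?case by simp
  qed simp
  have NW: "(r + j, c + j) \<in> V \<Longrightarrow> even (r + c) \<Longrightarrow> (r, c) \<in> V" for r c j
  proof (induction j)
    case (Suc j)
    then have "(r + j, c + j) \<in> V" using step(2)[of "r + j" "c + j"] by simp
    with Suc show ?case by simp
  qed simp
  obtain r c where rc: "x = (r, c)" by (cases x)
  have o: "even (r + c)" using main_strip_even[OF k] x rc by blast
  show ?thesis
  proof
    fix y assume y: "y \<in> main_strip n k"
    obtain r' c' where rc': "y = (r', c')" by (cases y)
    have e: "r + c' = r' + c" "Suc r' < n" "c' < n"
      using x y unfolding rc rc' main_strip_def by (auto split: if_splits)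
    have o': "even (r' + c')" using main_strip_even[OF k] y rc' by blast
    show "y \<in> V"
    proof (cases "r' \<le> r")
      case True
      then obtain j where "r = r' + j" using le_Suc_ex by blast
      moreover from this have "c = c' + j" using e by simp
      ultimately show ?thesis using NW[of r' j c'] x o' unfolding rc rc' by simp
    next
      case False
      then obtain j where "r' = r + j" using le_Suc_ex nat_le_linear by blast
      moreover from this have "c' = c + j" using e by simp
      ultimately show ?thesis using SE[of r c j] x e o unfolding rc rc' by simp
    qed
  qed
qed

text \<open>A strip-closed set is a union of complete strips.  The strips of length \<open>n - 1\<close> would reach the
corner monominoes.\<close>

lemma strip_closed_imp_strip_union:
  assumes n: "2 \<le> n" and V: "strip_closed n V"
  obtains p where "p \<in> admissible n" "V = strip_union n p"
proof -
  define A where "A = {k \<in> {1..n - 2}. anti_strip n k \<subseteq> V}"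
  define B where "B = {k \<in> {1..n - 2}. main_strip n k \<subseteq> V}"
  have free: "\<not> (r = r' \<and> (c' = Suc c \<or> c = Suc c') \<or> c = c' \<and> (r' = Suc r \<or> r = Suc r'))"
    if "(r, c) \<in> V" "(r', c') \<in> V" for r c r' c'
    using V that unfolding strip_closed_def by blast
  have "a + b \<le> n - 2" if ab: "a \<in> A" "b \<in> B" for a b
  proof (rule ccontr)
    assume "\<not> a + b \<le> n - 2"
    then have "\<exists>r c r' c'. (r, c) \<in> anti_strip n a \<and> (r', c') \<in> main_strip n b \<and>
      (r = r' \<and> (c' = Suc c \<or> c = Suc c') \<or> c = c' \<and> (r' = Suc r \<or> r = Suc r'))"
      using ab unfolding A_def B_def by (intro strips_conflict) auto
    with free ab show False unfolding A_def B_def by blast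
  qed
  then have "(A, B) \<in> admissible n" unfolding admissible_def A_def B_def by auto
  moreover have "V = strip_union n (A, B)"
  proof
    show "strip_union n (A, B) \<subseteq> V" unfolding strip_union_def A_def B_def by auto
    show "V \<subseteq> strip_union n (A, B)"
    proof
      fix x assume x: "x \<in> V"
      obtain r c where rc: "x = (r, c)" by (cases x)
      have g: "Suc r < n" "c < n" using V x unfolding rc strip_closed_def by blast+
      show "x \<in> strip_union n (A, B)"
      proof (cases "even (r + c)")
        case True
        then obtain k where k: "1 \<le> k" "k < n" "x \<in> main_strip n k"
          using ex_main_strip[OF g] rc by blast
        have sub: "main_strip n k \<subseteq> V" using whole_main_strip[OF V x k(3,1,2)] .
        have "k \<noteq> n - 1"
        proof
          assume "k = n - 1"
          then have "(0, 0) \<in> main_strip n k" using n unfolding main_strip_def by auto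
          with sub V show False unfolding strip_closed_def by blast
        qed
        with k sub show ?thesis unfolding strip_union_def B_def by auto
      next
        case False
        then obtain k where k: "1 \<le> k" "k < n" "x \<in> anti_strip n k"
          using ex_anti_strip[OF g] rc by blast
        have sub: "anti_strip n k \<subseteq> V" using whole_anti_strip[OF V x k(3,1,2)] .
        have "k \<noteq> n - 1"
        proof
          assume "k = n - 1"
          then have "(if even n then 0 else n - 2, if even n then n - 1 else 0) \<in> anti_strip n k"
            using n unfolding anti_strip_def by auto
          with sub V show False unfolding strip_closed_def by blast
        qed
        with k sub show ?thesis unfolding strip_union_def A_def by auto
      qed
    qed
  qed
  ultimately show thesis by (rule that)
qed

lemma inj_on_strip_union:
  assumes "2 \<le> n"
  shows "inj_on (strip_union n) (admissible n)"
proof (rule inj_on_inverseI)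
  let ?g = "\<lambda>V. ({k \<in> {1..n - 2}. anti_strip n k \<subseteq> V}, {k \<in> {1..n - 2}. main_strip n k \<subseteq> V})"
  fix p assume p: "p \<in> admissible n"
  obtain A B where AB: "p = (A, B)" by (cases p)
  have k: "1 \<le> k \<and> k \<le> n - 2 \<and> k < n" if "k \<in> A \<or> k \<in> B" for k
    using p assms that unfolding AB admissible_def by fastforce
  have A: "k \<in> A" if kk: "k \<in> {1..n - 2}" "anti_strip n k \<subseteq> strip_union n (A, B)" for k
  proof -
    have kn: "1 \<le> k" "k < n" using kk(1) assms unfolding atLeastAtMost_iff by linarith+
    then have "card (anti_strip n k) \<noteq> 0" using card_anti_strip[of k n] by simp
    then obtain r c where x: "(r, c) \<in> anti_strip n k" by (metis card.empty ex_in_conv surj_pair)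
    then have "odd (r + c)" using anti_strip_odd[OF kn] by blast
    with x kk(2) obtain a where "a \<in> A" "(r, c) \<in> anti_strip n a"
      using main_strip_even[of _ n r c] k unfolding strip_union_def by blast
    then show ?thesis using anti_strip_unique[OF x, of a] k kn by blast
  qed
  have B: "k \<in> B" if kk: "k \<in> {1..n - 2}" "main_strip n k \<subseteq> strip_union n (A, B)" for k
  proof -
    have kn: "1 \<le> k" "k < n" using kk(1) assms unfolding atLeastAtMost_iff by linarith+
    then have "card (main_strip n k) \<noteq> 0" using card_main_strip[of k n] by simp
    then obtain r c where x: "(r, c) \<in> main_strip n k" by (metis card.empty ex_in_conv surj_pair)
    then have "even (r + c)" using main_strip_even[OF kn] by blast
    with x kk(2) obtain a where "a \<in> B" "(r, c) \<in> main_strip n a"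
      using anti_strip_odd[of _ n r c] k unfolding strip_union_def by blast
    then show ?thesis using main_strip_unique[OF x, of a] k kn by blast
  qed
  have "\<And>k. k \<in> A \<Longrightarrow> anti_strip n k \<subseteq> strip_union n (A, B)"
    "\<And>k. k \<in> B \<Longrightarrow> main_strip n k \<subseteq> strip_union n (A, B)"
    unfolding strip_union_def by auto
  then have "{k \<in> {1..n - 2}. anti_strip n k \<subseteq> strip_union n (A, B)} = A"
    "{k \<in> {1..n - 2}. main_strip n k \<subseteq> strip_union n (A, B)} = B"
    using A B k unfolding atLeastAtMost_iff by blast+
  then show "?g (strip_union n p) = p" unfolding AB by simp
qed

lemma vdoms_brick_tiling: "card {t \<in> brick_tiling n V. is_vdom t} = card V"
proof -
  have "{t \<in> brick_tiling n V. is_vdom t} = (\<lambda>(r, c). VDom r c) ` V"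
  proof (intro set_eqI iffI)
    fix t assume "t \<in> {t \<in> brick_tiling n V. is_vdom t}"
    then show "t \<in> (\<lambda>(r, c). VDom r c) ` V" by (cases t) force+
  qed auto
  moreover have "inj_on (\<lambda>(r, c). VDom r c) V" by (auto simp: inj_on_def)
  ultimately show ?thesis by (simp add: card_image)
qed

text \<open>The correspondence between coverings in normal position and admissible pairs.\<close>

lemma card_cornered_perfect:
  assumes n: "2 \<le> n"
  shows "card {T. cornered_perfect n T \<and> card {t \<in> T. is_vdom t} = k} =
    card {p \<in> admissible n. \<Sum>(fst p) + \<Sum>(snd p) = k}"
proof -
  let ?f = "\<lambda>p. brick_tiling n (strip_union n p)"
  let ?P = "{p \<in> admissible n. \<Sum>(fst p) + \<Sum>(snd p) = k}"
  have vd: "card {t \<in> ?f p. is_vdom t} = \<Sum>(fst p) + \<Sum>(snd p)" if "p \<in> admissible n" for p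
    using card_strip_union[OF n, of "fst p" "snd p"] that vdoms_brick_tiling
    unfolding admissible_def by auto
  have inj: "inj_on ?f ?P"
  proof (rule inj_onI)
    fix p q assume pq: "p \<in> ?P" "q \<in> ?P" "?f p = ?f q"
    have "(r, c) \<in> strip_union n p \<longleftrightarrow> (r, c) \<in> strip_union n q" for r c
      using pq(3) in_brick_tiling(1) by metis
    then have "strip_union n p = strip_union n q" by auto
    with inj_on_strip_union[OF n] pq show "p = q" by (auto dest: inj_onD)
  qed
  have "?f ` ?P = {T. cornered_perfect n T \<and> card {t \<in> T. is_vdom t} = k}"
  proof (intro set_eqI iffI)
    fix T assume "T \<in> ?f ` ?P"
    then obtain p where "p \<in> ?P" "T = ?f p" by blast
    then show "T \<in> {T. cornered_perfect n T \<and> card {t \<in> T. is_vdom t} = k}"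
      using vd cornered_perfect_brick_tiling[OF n] strip_closed_strip_union[OF n]
      by (cases p) auto
  next
    fix T assume T: "T \<in> {T. cornered_perfect n T \<and> card {t \<in> T. is_vdom t} = k}"
    then interpret cornered_perfect n T by simp
    obtain p where p: "p \<in> admissible n" "{(r, c). VDom r c \<in> T} = strip_union n p"
      using strip_closed_imp_strip_union[OF n strip_closed_VDom] by blast
    have Tp: "T = ?f p" using eq_brick_tiling unfolding p(2) .
    moreover have "p \<in> ?P" using vd[OF p(1)] T p(1) unfolding Tp[symmetric] by auto
    ultimately show "T \<in> ?f ` ?P" by blast
  qed
  then show ?thesis using card_image[OF inj] by simp
qed

section \<open>Transposition\<close>

fun transpose_tile :: "tile \<Rightarrow> tile" where
  "transpose_tile (Mono r c) = Mono c r"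
| "transpose_tile (HDom r c) = VDom c r"
| "transpose_tile (VDom r c) = HDom c r"

lemma transpose_tile_twice [simp]: "transpose_tile (transpose_tile t) = t"
  by (cases t) auto

lemma transpose_tiling_twice [simp]: "transpose_tile ` transpose_tile ` T = T"
  by (simp add: image_image)

lemma inj_transpose_tile: "inj transpose_tile"
  by (metis injI transpose_tile_twice)

lemma in_transpose_tiling: "t \<in> transpose_tile ` T \<longleftrightarrow> transpose_tile t \<in> T"
  by (metis image_iff transpose_tile_twice)

lemma cells_transpose_tile: "cells (transpose_tile t) = prod.swap ` cells t"
  by (cases t) auto

lemma covering_transpose:
  assumes "covering n T"
  shows "covering n (transpose_tile ` T)"
proof -
  have "(\<Union>t\<in>transpose_tile ` T. cells t) = prod.swap ` (\<Union>t\<in>T. cells t)"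
    by (simp add: cells_transpose_tile image_UN)
  also have "\<dots> = {0..<n} \<times> {0..<n}"
    using assms unfolding covering_def by (simp add: product_swap)
  finally have union: "(\<Union>t\<in>transpose_tile ` T. cells t) = {0..<n} \<times> {0..<n}" .
  have disj: "cells t \<inter> cells u = {}"
    if tu: "t \<in> transpose_tile ` T" "u \<in> transpose_tile ` T" "t \<noteq> u" for t u
  proof -
    obtain t' where t: "t = transpose_tile t'" "t' \<in> T" using tu(1) by (rule imageE)
    obtain u' where u: "u = transpose_tile u'" "u' \<in> T" using tu(2) by (rule imageE)
    have "t' \<noteq> u'" using tu(3) t(1) u(1) by blast
    then have "cells t' \<inter> cells u' = {}"
      using assms t(2) u(2) unfolding covering_def by blast
    then show ?thesis
      unfolding t(1) u(1) cells_transpose_tile image_Int[OF inj_swap, symmetric] by simp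
  qed
  show ?thesis unfolding covering_def using union disj by blast
qed

lemma perfect_transpose:
  assumes "perfect n T"
  shows "perfect n (transpose_tile ` T)"
  using assms covering_transpose unfolding perfect_def in_transpose_tiling transpose_tile.simps
  by meson

lemma tatami_T_perfect: "tatami_T n = {T. perfect n T \<and> Mono 0 0 \<in> T \<and> Mono 0 (n - 1) \<in> T}"
  unfolding tatami_T_def perfect_iff_tatami by auto

lemma count_V_even:
  assumes "2 \<le> n" "even n"
  shows "count_V n k = card {T. cornered_perfect n T \<and> card {t \<in> T. is_vdom t} = k}"
proof -
  have "T \<in> tatami_T n \<longleftrightarrow> cornered_perfect n T" for T
    unfolding tatami_T_perfect cornered_perfect_def using assms by simp
  then show ?thesis unfolding count_V_def by simp
qed

text \<open>For odd \<open>n\<close> the coverings to be counted consist mainly of vertical dominoes, and transposition brings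
them into normal position.\<close>

lemma count_H_odd:
  assumes "2 \<le> n" "odd n"
  shows "count_H n k = card {T. cornered_perfect n T \<and> card {t \<in> T. is_vdom t} = k}"
proof -
  let ?X = "{T \<in> tatami_T n. card {t \<in> T. is_hdom t} = k}"
  let ?Y = "{T. cornered_perfect n T \<and> card {t \<in> T. is_vdom t} = k}"
  have hv: "card {t \<in> transpose_tile ` T. is_vdom t} = card {t \<in> T. is_hdom t}" for T
  proof -
    have "is_vdom (transpose_tile t) \<longleftrightarrow> is_hdom t" for t by (cases t) auto
    then have "{t \<in> transpose_tile ` T. is_vdom t} = transpose_tile ` {t \<in> T. is_hdom t}" by auto
    then show ?thesis
      using card_image[OF inj_on_subset[OF inj_transpose_tile subset_UNIV]] by simp
  qed
  have cp: "cornered_perfect n (transpose_tile ` T) \<longleftrightarrow> T \<in> tatami_T n" for T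
    unfolding cornered_perfect_def tatami_T_perfect in_transpose_tiling using assms
    using perfect_transpose[of n T] perfect_transpose[of n "transpose_tile ` T"] by auto
  have "bij_betw ((`) transpose_tile) ?X ?Y"
  proof (rule bij_betw_byWitness[where f' = "(`) transpose_tile"])
    show "(`) transpose_tile ` ?X \<subseteq> ?Y" using cp hv by auto
    show "(`) transpose_tile ` ?Y \<subseteq> ?X"
    proof
      fix S assume "S \<in> (`) transpose_tile ` ?Y"
      then obtain T where T: "cornered_perfect n T" "card {t \<in> T. is_vdom t} = k"
        "S = transpose_tile ` T" by blast
      then show "S \<in> ?X" using cp[of S] hv[of S] by simp
    qed
  qed simp_all
  then show ?thesis unfolding count_H_def by (rule bij_betw_same_card)
qed

section \<open>The generating function\<close>

lemma S_poly_subsets: "S_poly s = (\<Sum>B\<in>Pow {1..s}. monom 1 (\<Sum>B))"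
proof -
  have m: "(\<Prod>i\<in>B. monom (1::int) i) = monom 1 (\<Sum>B)" if "finite B" for B :: "nat set"
    using that by induction (simp_all add: mult_monom)
  have "S_poly s = (\<Sum>B\<in>Pow {1..s}. (\<Prod>i\<in>B. monom 1 i))"
    unfolding S_poly_def by (subst add.commute, subst prod_add) simp_all
  also have "\<dots> = (\<Sum>B\<in>Pow {1..s}. monom 1 (\<Sum>B))"
    by (rule sum.cong) (auto intro!: m intro: finite_subset)
  finally show ?thesis .
qed

definition weight_monom :: "nat set \<times> nat set \<Rightarrow> int poly" where
  "weight_monom p = monom 1 (\<Sum>(fst p) + \<Sum>(snd p))"

lemma S_poly_times: "S_poly a * S_poly b = (\<Sum>p\<in>Pow {1..a} \<times> Pow {1..b}. weight_monom p)"
  unfolding S_poly_subsets sum_product sum.cartesian_product weight_monom_def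
  by (simp add: mult_monom case_prod_unfold)

lemma finite_admissible: "finite (admissible n)"
  by (rule finite_subset[of _ "Pow {1..n - 2} \<times> Pow {1..n - 2}"]) (auto simp: admissible_def)

text \<open>The index \<open>i\<close> records the largest element \<open>n - i - 1\<close> of the first set.  All elements of the second
set are then below \<open>i\<close>, which makes them compatible with every number up to \<open>n - i - 1\<close>, so the
remaining elements of the two sets are independent.\<close>

lemma sum_large_first:
  assumes n: "2 \<le> n"
  shows "(\<Sum>p\<in>{p \<in> admissible n. \<exists>a\<in>fst p. (n - 2) div 2 < a}. weight_monom p) =
    (\<Sum>i = 1..(n - 1) div 2. S_poly (n - i - 2) * S_poly (i - 1) * monom 1 (n - i - 1))"
proof -
  let ?L = "{p \<in> admissible n. \<exists>a\<in>fst p. (n - 2) div 2 < a}"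
  let ?I = "{1..(n - 1) div 2}"
  let ?Q = "\<lambda>i. Pow {1..n - i - 2} \<times> Pow {1..i - 1}"
  have "(\<Sum>i\<in>?I. S_poly (n - i - 2) * S_poly (i - 1) * monom 1 (n - i - 1)) =
      (\<Sum>i\<in>?I. \<Sum>q\<in>?Q i. weight_monom q * monom 1 (n - i - 1))"
    unfolding S_poly_times sum_distrib_right ..
  also have "\<dots> = (\<Sum>(i, q)\<in>Sigma ?I ?Q. weight_monom q * monom 1 (n - i - 1))"
    by (rule sum.Sigma) auto
  also have "\<dots> = (\<Sum>p\<in>?L. weight_monom p)"
  proof (rule sum.reindex_bij_witness[where
        j = "\<lambda>(i, q). (insert (n - i - 1) (fst q), snd q)" and
        i = "\<lambda>p. (n - 1 - Max (fst p), (fst p - {Max (fst p)}, snd p))"])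
    fix x assume x: "x \<in> Sigma ?I ?Q"
    obtain i A B where iAB: "x = (i, (A, B))" by (cases x) auto
    have i: "1 \<le> i" "i \<le> (n - 1) div 2" and A: "A \<subseteq> {1..n - i - 2}" and B: "B \<subseteq> {1..i - 1}"
      using x unfolding iAB by auto
    have fin: "finite A" "finite B" using A B by (auto intro: finite_subset)
    have lt: "n - i - 2 < n - i - 1" using i by linarith
    have Alt: "a < n - i - 1" if "a \<in> A" for a
      using subsetD[OF A that] lt unfolding atLeastAtMost_iff by linarith
    then have nA: "n - i - 1 \<notin> A" by blast
    have M: "Max (insert (n - i - 1) A) = n - i - 1"
      using Alt fin by (intro Max_eqI) (auto intro: less_imp_le)
    have big: "(n - 2) div 2 < n - i - 1" "n - 1 - (n - i - 1) = i" using i n by linarith+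
    show "(\<lambda>p. (n - 1 - Max (fst p), (fst p - {Max (fst p)}, snd p)))
        ((\<lambda>(i, q). (insert (n - i - 1) (fst q), snd q)) x) = x"
      unfolding iAB using M nA big by simp
    have ab: "a + b \<le> n - 2" if "a \<in> insert (n - i - 1) A" "b \<in> B" for a b
    proof -
      have "a \<le> n - i - 1" using that(1) by (auto dest!: Alt)
      moreover have "b \<le> i - 1" using that(2) B by auto
      moreover note i n
      ultimately show ?thesis by linarith
    qed
    have "A \<subseteq> {1..n - 2}" "B \<subseteq> {1..n - 2}" "n - i - 1 \<in> {1..n - 2}"
      using A B i n by (auto dest!: subsetD)
    then have "(insert (n - i - 1) A, B) \<in> admissible n"
      unfolding admissible_def using ab by blast
    then show "(\<lambda>(i, q). (insert (n - i - 1) (fst q), snd q)) x \<in> ?L"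
      unfolding iAB using big by simp
    show "weight_monom ((\<lambda>(i, q). (insert (n - i - 1) (fst q), snd q)) x) =
        (case x of (i, q) \<Rightarrow> weight_monom q * monom 1 (n - i - 1))"
      unfolding iAB weight_monom_def using fin nA by (simp add: mult_monom ac_simps)
  next
    fix p assume p: "p \<in> ?L"
    obtain A B where AB: "p = (A, B)" by (cases p)
    have A: "A \<subseteq> {1..n - 2}" and B: "B \<subseteq> {1..n - 2}" and ab: "\<And>a b. a \<in> A \<Longrightarrow> b \<in> B \<Longrightarrow> a + b \<le> n - 2"
      and ex: "\<exists>a\<in>A. (n - 2) div 2 < a"
      using p unfolding AB admissible_def by auto
    have fin: "finite A" using A by (auto intro: finite_subset)
    define m where "m = Max A"
    have mA: "m \<in> A" unfolding m_def using ex fin by (intro Max_in) auto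
    have mm: "a \<le> m" if "a \<in> A" for a unfolding m_def using that fin by simp
    have m1: "(n - 2) div 2 < m" using ex mm by force
    have m2: "1 \<le> m" "m \<le> n - 2" using mA A by auto
    have i: "1 \<le> n - 1 - m" "n - 1 - m \<le> (n - 1) div 2" "n - (n - 1 - m) - 1 = m"
      "n - (n - 1 - m) - 2 = m - 1"
      using m1 m2 n by linarith+
    show "(\<lambda>(i, q). (insert (n - i - 1) (fst q), snd q))
        ((\<lambda>p. (n - 1 - Max (fst p), (fst p - {Max (fst p)}, snd p))) p) = p"
      unfolding AB using i mA by (auto simp flip: m_def)
    have "A - {m} \<subseteq> {1..m - 1}"
    proof
      fix a assume "a \<in> A - {m}"
      then have "1 \<le> a" "a \<le> m" "a \<noteq> m" using A mm by auto
      then show "a \<in> {1..m - 1}" by simp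
    qed
    moreover have "B \<subseteq> {1..n - 1 - m - 1}"
    proof
      fix b assume b: "b \<in> B"
      then have "1 \<le> b" "m + b \<le> n - 2" using B ab mA by auto
      then show "b \<in> {1..n - 1 - m - 1}" using n by simp
    qed
    ultimately show "(\<lambda>p. (n - 1 - Max (fst p), (fst p - {Max (fst p)}, snd p))) p \<in> Sigma ?I ?Q"
      unfolding AB using i by (auto simp flip: m_def)
  qed
  finally show ?thesis ..
qed

text \<open>Two elements above \<open>(n - 2) div 2\<close> have a sum above \<open>n - 2\<close>, so an admissible pair has them in the
first set, in the second, or in neither.\<close>

lemma W_poly_admissible:
  assumes n: "2 \<le> n"
  shows "W_poly n = (\<Sum>p\<in>admissible n. weight_monom p)"
proof -
  let ?h = "(n - 2) div 2"
  let ?S = "Pow {1..?h} \<times> Pow {1..?h}"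
  let ?L = "{p \<in> admissible n. \<exists>a\<in>fst p. ?h < a}"
  let ?R = "{p \<in> admissible n. \<exists>b\<in>snd p. ?h < b}"
  have eq: "admissible n = (?L \<union> ?R) \<union> ?S"
  proof
    show "admissible n \<subseteq> (?L \<union> ?R) \<union> ?S"
    proof
      fix p assume p: "p \<in> admissible n"
      show "p \<in> (?L \<union> ?R) \<union> ?S"
      proof (cases "p \<in> ?L \<union> ?R")
        case False
        then have "\<forall>a\<in>fst p \<union> snd p. a \<le> ?h" using p by (auto simp: not_less)
        moreover have "\<forall>a\<in>fst p \<union> snd p. 1 \<le> a" using p unfolding admissible_def by auto
        ultimately show ?thesis by (cases p) auto
      qed simp
    qed
    have "?S \<subseteq> admissible n"
    proof
      fix p assume "p \<in> ?S"
      then obtain A B where p: "p = (A, B)" "A \<subseteq> {1..?h}" "B \<subseteq> {1..?h}" by auto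
      have "a + b \<le> n - 2" if "a \<in> A" "b \<in> B" for a b
      proof -
        have "a \<le> ?h" "b \<le> ?h" using p that by auto
        then show ?thesis by linarith
      qed
      moreover have "{1..?h} \<subseteq> {1..n - 2}" by auto
      ultimately show "p \<in> admissible n" using p unfolding admissible_def by blast
    qed
    then show "(?L \<union> ?R) \<union> ?S \<subseteq> admissible n" by blast
  qed
  have d1: "?L \<inter> ?R = {}"
  proof (rule equals0I)
    fix p assume p: "p \<in> ?L \<inter> ?R"
    then obtain a b where ab: "a \<in> fst p" "b \<in> snd p" "?h < a" "?h < b" by blast
    then have "a + b \<le> n - 2" using p unfolding admissible_def by auto
    with ab show False by linarith
  qed
  have d2: "(?L \<union> ?R) \<inter> ?S = {}" by force
  have fin: "finite ?L" "finite ?R" "finite ?S" using finite_admissible by auto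
  have swap: "prod.swap p \<in> admissible n" if "p \<in> admissible n" for p
  proof -
    obtain A B where p: "p = (A, B)" by (cases p)
    have "\<forall>a\<in>A. \<forall>b\<in>B. a + b \<le> n - 2"
      using that unfolding p admissible_def by blast
    then have "\<forall>b\<in>B. \<forall>a\<in>A. b + a \<le> n - 2"
      by (metis add.commute)
    then show ?thesis using that unfolding p admissible_def by auto
  qed
  have swap_iff: "prod.swap p \<in> admissible n \<longleftrightarrow> p \<in> admissible n" for p
    using swap[of p] swap[of "prod.swap p"] by auto
  have "(\<Sum>p\<in>?R. weight_monom p) = (\<Sum>p\<in>?L. weight_monom p)"
    by (rule sum.reindex_bij_witness[where i = prod.swap and j = prod.swap])
      (simp_all add: weight_monom_def add.commute swap_iff)
  moreover have "(\<Sum>p\<in>admissible n. weight_monom p) = (\<Sum>p\<in>(?L \<union> ?R) \<union> ?S. weight_monom p)"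
    using eq by (rule sum.cong) simp
  moreover have "\<dots> = (\<Sum>p\<in>?L. weight_monom p) + (\<Sum>p\<in>?R. weight_monom p) + (\<Sum>p\<in>?S. weight_monom p)"
    using sum.union_disjoint[OF finite_UnI[OF fin(1,2)] fin(3) d2, of weight_monom]
      sum.union_disjoint[OF fin(1,2) d1, of weight_monom] by argo
  ultimately have "(\<Sum>p\<in>admissible n. weight_monom p) =
      2 * (\<Sum>p\<in>?L. weight_monom p) + (\<Sum>p\<in>?S. weight_monom p)"
    by (simp only: mult_2)
  then show ?thesis
    unfolding W_poly_def sum_large_first[OF n] S_poly_times[symmetric] power2_eq_square by simp
qed

lemma coeff_W_poly_admissible:
  assumes "2 \<le> n"
  shows "coeff (W_poly n) k = int (card {p \<in> admissible n. \<Sum>(fst p) + \<Sum>(snd p) = k})"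
  unfolding W_poly_admissible[OF assms] weight_monom_def
  using finite_admissible by (simp add: coeff_sum sum.If_cases Int_def)

text \<open>Subset sums are non-negative, so the pairs of integers in the convolution come from the natural
numbers up to \<open>m\<close>, as in the product of the polynomials.\<close>

lemma subset_sums_conv_coeff:
  "int (subset_sums_conv a b m) = (if m < 0 then 0 else coeff (S_poly a * S_poly b) (nat m))"
proof -
  let ?N = "{(k1, k2). k1 + k2 = m \<and> subset_sums a k1 \<noteq> 0 \<and> subset_sums b k2 \<noteq> 0}"
  have pos: "0 \<le> k1 \<and> 0 \<le> k2" if "(k1, k2) \<in> ?N" for k1 k2
    using that subset_sums_neg[of k1 a] subset_sums_neg[of k2 b] by (auto simp flip: not_less)
  show ?thesis
  proof (cases "m < 0")
    case True
    then have N: "?N = {}" using pos by fastforce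
    show ?thesis using True unfolding subset_sums_conv_def N by simp
  next
    case False
    define g where "g = (\<lambda>i. (int i, m - int i))"
    have inj: "inj_on g {..nat m}" unfolding g_def by (auto simp: inj_on_def)
    have sub: "?N \<subseteq> g ` {..nat m}"
    proof
      fix x assume x: "x \<in> ?N"
      obtain k1 k2 where k: "x = (k1, k2)" by (cases x)
      have "0 \<le> k1" "0 \<le> k2" "k1 + k2 = m" using pos x unfolding k by auto
      then show "x \<in> g ` {..nat m}" unfolding k g_def by (intro image_eqI[of _ _ "nat k1"]) auto
    qed
    have "subset_sums_conv a b m = (\<Sum>(k1, k2)\<in>g ` {..nat m}. subset_sums a k1 * subset_sums b k2)"
      unfolding subset_sums_conv_def
      by (rule sum.mono_neutral_left) (use sub in \<open>auto simp: g_def\<close>)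
    also have "\<dots> = (\<Sum>i\<le>nat m. subset_sums a (int i) * subset_sums b (m - int i))"
      by (subst sum.reindex[OF inj]) (simp add: g_def)
    also have "int \<dots> = (\<Sum>i\<le>nat m. coeff (S_poly a) i * coeff (S_poly b) (nat m - i))"
      using False by (auto simp: coeff_S_poly of_nat_diff intro!: sum.cong)
    finally show ?thesis using False by (simp add: coeff_mult)
  qed
qed

lemma coeff_W_poly_W_num:
  assumes "2 \<le> n"
  shows "coeff (W_poly n) k = int (W_num n k)"
proof -
  have shift: "coeff (p * monom 1 d) k = (if k < d then 0 else coeff p (k - d))" for p :: "int poly" and d
    using coeff_monom_mult[of 1 d p k] unfolding mult.commute[of p "monom 1 d"] by simp
  have "int (subset_sums_conv (n - i - 2) (i - 1) (int k - int (n - i - 1))) =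
      coeff (S_poly (n - i - 2) * S_poly (i - 1) * monom 1 (n - i - 1)) k" for i
  proof (cases "k < n - i - 1")
    case False
    then have "nat (int k - int (n - i - 1)) = k - (n - i - 1)" by simp
    with False show ?thesis unfolding subset_sums_conv_coeff shift by simp
  qed (simp only: subset_sums_conv_coeff shift; simp)
  moreover have "int (subset_sums_conv ((n - 2) div 2) ((n - 2) div 2) (int k)) =
      coeff ((S_poly ((n - 2) div 2))\<^sup>2) k"
    unfolding subset_sums_conv_coeff power2_eq_square by simp
  ultimately show ?thesis
    unfolding W_poly_def W_num_def mult_2 coeff_add coeff_sum of_nat_add of_nat_sum by simp
qed

theorem theorem1:
  fixes n :: nat
  assumes "n \<ge> 2"
  shows "fps_of_poly (W_poly n) = Abs_fps (\<lambda>k. int (W_num n k)) \<and>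
    (even n \<longrightarrow> fps_of_poly (W_poly n) = Abs_fps (\<lambda>k. int (count_V n k))) \<and>
    (odd n \<longrightarrow> fps_of_poly (W_poly n) = Abs_fps (\<lambda>k. int (count_H n k)))"
  using coeff_W_poly_W_num[OF assms] coeff_W_poly_admissible[OF assms]
    card_cornered_perfect[OF assms] count_V_even[OF assms] count_H_odd[OF assms]
  by (simp add: fps_eq_iff)

end
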